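(* Assume that $$\{\bm{v}^\top\in\mathbb{R}^m_+\mid \bm{v}P\le\bm{0}\}\subseteq\mathbb{R}^m_{++}\cup\{\bm{0}\}\quad\text{and}\quad \emptyset\ne\{\bm{u}^\top\in\mathbb{R}^s_+\mid \bm{u}Q\le\bm{0},\ \bm{u}\ne\bm{0}\}\subseteq\mathbb{R}^s_{++}.$$ Then the efficiency measures $F_S^\natural$ and $F_B^\natural$ over $T\cap\big((\mathbb{R}^m_+\setminus\{\bm{0}\})\times(\mathbb{R}^s_+\setminus\{\bm{0}\})\big)$ satisfy (I) and (WM). Furthermore, if $m\le s$, then $F_B^\natural$ over $T\cap\big((\mathbb{R}^m_+\setminus\{\bm{0}\})\times(\mathbb{R}^s_+\setminus\{\bm{0}\})\big)$ satisfies (SM).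
   Context: There are $n$ decision making units; unit $j$ has input vector $\bm{x}_j\in\mathbb{R}^m_+\setminus\{\bm{0}\}$ and output vector $\bm{y}_j\in\mathbb{R}^s_+\setminus\{\bm{0}\}$, $j=1,\dots,n$ (zero entries are allowed). $P$ is a given real matrix with $m$ rows and $Q$ a given real matrix with $s$ rows. $\mathbb{R}^L_+$ and $\mathbb{R}^L_{++}$ denote vectors with all entries nonnegative, respectively strictly positive; $\bm{v},\bm{u}$ are row vectors; $\bm{e}_i$, $\bm{e}_r$ are unit vectors of $\mathbb{R}^m$, $\mathbb{R}^s$; $I(\bm{z})=\{l\mid z_l>0\}$ for $\bm{z}\in\mathbb{R}^L_+$. Vector inequalities are componentwise. The production possibility set is $$T=\Big\{(\bm{x},\bm{y})\in\mathbb{R}^m\times\mathbb{R}^s\ \Big|\ \sum_{j=1}^n\lambda_j\bm{x}_j-P\bm{\alpha}\le\bm{x},\ \sum_{j=1}^n\lambda_j\bm{y}_j+Q\bm{\beta}\ge\bm{y}\ \text{ for some }\bm{\lambda}\ge\bm{0},\bm{\alpha}\ge\bm{0},\bm{\beta}\ge\bm{0}\Big\}.$$ The strongly efficient frontier $\partial^s(T)$ is the set of $(\bm{x},\bm{y})\in T$ such that whenever $(\bm{x},-\bm{y})\ge(\bm{x}',-\bm{y}')$ and $(\bm{x},-\bm{y})\ne(\bm{x}',-\bm{y}')$, one has $(\bm{x}',\bm{y}')\notin T$. Let $g^\natural_{\bm{x}}(\bm{\delta}^-)=1-\frac1m\sum_{i\in I(\bm{x})}\delta_i^-$, $\ g^\natural_{\bm{y}}(\bm{\delta}^+)=\dfrac{s}{s+\sum_{r\in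 I(\bm{y})}\delta_r^+}$, $\ h^\natural_{\bm{y}}(\bm{\delta}^+)=\frac1s\sum_{r\in I(\bm{y})}\frac{1}{1+\delta_r^+}+1-\frac1s|I(\bm{y})|$. Let $\Phi(\bm{x},\bm{y})$ be the set of $(\bm{\delta}^-,\bm{\delta}^+)\ge(\bm{0},\bm{0})$ in $\mathbb{R}^m\times\mathbb{R}^s$ with $\delta_i^-=0$ for $i\notin I(\bm{x})$, $\delta_r^+=0$ for $r\notin I(\bm{y})$, and $\big(\bm{x}-\sum_{i\in I(\bm{x})}\delta_i^-x_i\bm{e}_i,\ \bm{y}+\sum_{r\in I(\bm{y})}\delta_r^+y_r\bm{e}_r\big)\in\partial^s(T)$. Then $$F_S^\natural(\bm{x},\bm{y})=\max_{(\bm{\delta}^-,\bm{\delta}^+)\in\Phi(\bm{x},\bm{y})}g^\natural_{\bm{x}}(\bm{\delta}^-)\,g^\natural_{\bm{y}}(\bm{\delta}^+),\qquad F_B^\natural(\bm{x},\bm{y})=\max_{(\bm{\delta}^-,\bm{\delta}^+)\in\Phi(\bm{x},\bm{y})}g^\natural_{\bm{x}}(\bm{\delta}^-)\,h^\natural_{\bm{y}}(\bm{\delta}^+).$$ Axioms for an efficiency measure $F$ over a domain $\mathcal{D}\subseteq T$: (I) for all $(\bm{x},\bm{y})\in\mathcal{D}$, $F(\bm{x},\bm{y})=1$ if and only if $(\bm{x},\bm{y})\in\partial^s(T)$; (WM) for all $(\bm{x},\bm{y}),(\bm{x}',\bm{y}')\in\mathcal{D}$ with $(\bm{x},-\bm{y})\le(\bm{x}',-\bm{y}')$,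 $F(\bm{x},\bm{y})\ge F(\bm{x}',\bm{y}')$; (SM) for all $(\bm{x},\bm{y}),(\bm{x}',\bm{y}')\in\mathcal{D}$ with $(\bm{x},-\bm{y})\le(\bm{x}',-\bm{y}')$ and $(\bm{x},-\bm{y})\ne(\bm{x}',-\bm{y}')$, $F(\bm{x},\bm{y})>F(\bm{x}',\bm{y}')$.
   Formalization: The frontier of T is assumed nonempty (otherwise F is a max over the empty set); (WM), false as stated for F_S and for F_B with m>s, is proved there with Φ restricted to targets with nonnegative inputs; (I), (SM), and (WM) of F_B for m≤s keep the original Φ. *)

theory Defs
  imports "HOL-Analysis.Analysis"
begin

text \<open>
  Vectors and matrices are those of HOL-Analysis: the order on \<^typ>\<open>real ^ 'm\<close> is componentwise,
  a row vector times a matrix is \<^term>\<open>v v* P\<close>, and \<^term>\<open>axis i 1\<close> is a unit vector.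
  An activity is a pair of an input vector and an output vector.
\<close>

type_synonym ('m, 's) activity = "(real ^ 'm) \<times> (real ^ 's)"

definition strictly_positive :: "real ^ 'd::finite \<Rightarrow> bool" where
  "strictly_positive z \<longleftrightarrow> (\<forall>i. 0 < z $ i)"

definition support :: "real ^ 'd::finite \<Rightarrow> 'd set" where
  "support z = {i. 0 < z $ i}"

definition production_set ::
  "('n::finite \<Rightarrow> real ^ 'm::finite) \<Rightarrow> ('n \<Rightarrow> real ^ 's::finite) \<Rightarrow> real ^ 'k ^ 'm \<Rightarrow> real ^ 'l ^ 's
    \<Rightarrow> ('m, 's) activity set" where
  "production_set X Y P Q = {(x, y). \<exists>(lam :: 'n \<Rightarrow> real) (alpha :: real ^ 'k) (beta :: real ^ 'l).
      (\<forall>j. 0 \<le> lam j) \<and> 0 \<le> alpha \<and> 0 \<le> beta \<and>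
      (\<Sum>j\<in>UNIV. lam j *\<^sub>R X j) - P *v alpha \<le> x \<and>
      y \<le> (\<Sum>j\<in>UNIV. lam j *\<^sub>R Y j) + Q *v beta}"

text \<open>\<^term>\<open>dominates z z'\<close>: \<open>z = (x, y)\<close> and \<open>z' = (x', y')\<close> satisfy \<open>(x, -y) \<le> (x', -y')\<close>.\<close>

definition dominates :: "('m::finite, 's::finite) activity \<Rightarrow> ('m, 's) activity \<Rightarrow> bool" where
  "dominates z z' \<longleftrightarrow> fst z \<le> fst z' \<and> - snd z \<le> - snd z'"

definition strongly_efficient :: "('m::finite, 's::finite) activity set \<Rightarrow> ('m, 's) activity set" where
  "strongly_efficient T = {z \<in> T. \<forall>z'. dominates z' z \<and> z' \<noteq> z \<longrightarrow> z' \<notin> T}"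

definition semipositive_activities :: "('m::finite, 's::finite) activity set" where
  "semipositive_activities = ({x. 0 \<le> x} - {0}) \<times> ({y. 0 \<le> y} - {0})"

definition g_in :: "real ^ 'm::finite \<Rightarrow> real ^ 'm \<Rightarrow> real" where
  "g_in x d = 1 - (\<Sum>i\<in>support x. d $ i) / real CARD('m)"

definition g_out :: "real ^ 's::finite \<Rightarrow> real ^ 's \<Rightarrow> real" where
  "g_out y e = real CARD('s) / (real CARD('s) + (\<Sum>r\<in>support y. e $ r))"

definition h_out :: "real ^ 's::finite \<Rightarrow> real ^ 's \<Rightarrow> real" where
  "h_out y e = (\<Sum>r\<in>support y. 1 / (1 + e $ r)) / real CARD('s) + 1
     - real (card (support y)) / real CARD('s)"

definition score_S :: "('m::finite, 's::finite) activity \<Rightarrow> ('m, 's) activity \<Rightarrow> real" where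
  "score_S z de = g_in (fst z) (fst de) * g_out (snd z) (snd de)"

definition score_B :: "('m::finite, 's::finite) activity \<Rightarrow> ('m, 's) activity \<Rightarrow> real" where
  "score_B z de = g_in (fst z) (fst de) * h_out (snd z) (snd de)"

definition target :: "('m::finite, 's::finite) activity \<Rightarrow> ('m, 's) activity \<Rightarrow> ('m, 's) activity" where
  "target z de =
     (fst z - (\<Sum>i\<in>support (fst z). (fst de $ i * fst z $ i) *\<^sub>R axis i 1),
      snd z + (\<Sum>r\<in>support (snd z). (snd de $ r * snd z $ r) *\<^sub>R axis r 1))"

definition Phi :: "('m::finite, 's::finite) activity set \<Rightarrow> ('m, 's) activity \<Rightarrow> ('m, 's) activity set" where
  "Phi T z = {de. 0 \<le> fst de \<and> 0 \<le> snd de \<and>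
      (\<forall>i. i \<notin> support (fst z) \<longrightarrow> fst de $ i = 0) \<and>
      (\<forall>r. r \<notin> support (snd z) \<longrightarrow> snd de $ r = 0) \<and>
      target z de \<in> strongly_efficient T}"

text \<open>
  Since \<^const>\<open>production_set\<close> is not confined to nonnegative inputs, a target may have negative
  inputs (some input reduction rate exceeds 1).  The following variant of \<^const>\<open>Phi\<close> admits only
  targets whose input vector is nonnegative.  The difference matters for weak monotonicity:
  if \<open>T = {(x, y). max y 0 \<le> x\<^sub>1 + x\<^sub>2}\<close> (two inputs, one output), the maximum over \<^const>\<open>Phi\<close> of either
  score is 1/10 at \<open>((1/2, 1/2), 1/10)\<close>, but it is at least 3/10 at the dominated
  activity \<open>((1, 1/2), 1/10)\<close>, through the target \<open>((-2/5, 1/2), 1/10)\<close>.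
\<close>

definition Phi_nonneg :: "('m::finite, 's::finite) activity set \<Rightarrow> ('m, 's) activity \<Rightarrow> ('m, 's) activity set" where
  "Phi_nonneg T z = {de \<in> Phi T z. 0 \<le> fst (target z de)}"

definition attains_max :: "('a \<Rightarrow> real) \<Rightarrow> 'a set \<Rightarrow> bool" where
  "attains_max f A \<longleftrightarrow> (\<exists>a\<in>A. \<forall>b\<in>A. f b \<le> f a)"

text \<open>The maximum of \<^term>\<open>f\<close> over \<^term>\<open>A\<close>; meaningful only if \<^term>\<open>attains_max f A\<close>.\<close>

definition max_over :: "('a \<Rightarrow> real) \<Rightarrow> 'a set \<Rightarrow> real" where
  "max_over f A = (GREATEST t. t \<in> f ` A)"

text \<open>The two measures, for a given family of admissible reduction and expansion rates.\<close>

definition F_S :: "(('m::finite, 's::finite) activity \<Rightarrow> ('m, 's) activity set) \<Rightarrow> ('m, 's) activity \<Rightarrow> real" where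
  "F_S Adm z = max_over (score_S z) (Adm z)"

definition F_B :: "(('m::finite, 's::finite) activity \<Rightarrow> ('m, 's) activity set) \<Rightarrow> ('m, 's) activity \<Rightarrow> real" where
  "F_B Adm z = max_over (score_B z) (Adm z)"

definition axiom_I ::
  "('m::finite, 's::finite) activity set \<Rightarrow> (('m, 's) activity \<Rightarrow> real) \<Rightarrow> ('m, 's) activity set \<Rightarrow> bool" where
  "axiom_I T F D \<longleftrightarrow> (\<forall>z\<in>D. F z = 1 \<longleftrightarrow> z \<in> strongly_efficient T)"

definition axiom_WM :: "(('m::finite, 's::finite) activity \<Rightarrow> real) \<Rightarrow> ('m, 's) activity set \<Rightarrow> bool" where
  "axiom_WM F D \<longleftrightarrow> (\<forall>z\<in>D. \<forall>z'\<in>D. dominates z z' \<longrightarrow> F z \<ge> F z')"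

definition axiom_SM :: "(('m::finite, 's::finite) activity \<Rightarrow> real) \<Rightarrow> ('m, 's) activity set \<Rightarrow> bool" where
  "axiom_SM F D \<longleftrightarrow> (\<forall>z\<in>D. \<forall>z'\<in>D. dominates z z' \<and> z \<noteq> z' \<longrightarrow> F z > F z')"

end

theory Submission
  imports Defs
begin

text \<open>
  The production set \<open>T\<close> is a closed convex cone, and the weight conditions allow every slack in it to be
  spread over the other components: by Gordan's alternative (\<open>trade_direction\<close>) there is, for each input
  \<open>i\<close>, a direction of \<open>T\<close> that lowers all inputs but the \<open>i\<close>-th, and similarly
  for outputs.  Input slack yields output slack by adding a unit; conversely, because of a positive \<open>u\<close>
  with \<open>u v* Q \<le> 0\<close>, semipositive outputs need an active unit, and running it a little less turns
  output slack into input slack (\<open>production_set_contractible\<close>).  Hence a point of \<open>T\<close> with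
  nonnegative nonzero outputs that is dominated by another point of \<open>T\<close> is beaten in all coordinates at
  once, so weak and strong efficiency agree there (\<open>weakly_efficient_iff\<close>).  Weak efficiency is a closed
  condition, and the points of \<open>T\<close> dominating a given one form a bounded set, since an unbounded one would
  produce a free lunch, which the existence of an efficient point excludes.  So the admissible rates form a compact set
  and the maxima exist.  It also follows that shrinking rates whose target lies outside \<open>T\<close> leads to an
  efficient target (\<open>scale_to_frontier\<close>): as long as its input factor is nonnegative, an infeasible target
  bounds the measure from below by its score.

  Rates vanish off the support, so both scores depend on the rates alone and not on the activity: they are the product
  of one minus the mean reduction with \<open>1 / (1 + mean expansion)\<close> or with the mean of \<open>1 / (1 +
  expansion)\<close>, and they decrease strictly in the rates as long as the first factor is positive. Axiom (I) is
  immediate, because score 1 forces zero rates.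

  For monotonicity let \<open>(x, y)\<close> dominate \<open>(x', y')\<close> and let \<open>(a', b')\<close> be an
  efficient target of the latter with \<open>a' \<ge> 0\<close>.  Then \<open>(min a' x, max b' y)\<close> dominates
  \<open>(a', b')\<close>, so it is either equal to it or outside \<open>T\<close>, and the rates that lead from
  \<open>(x, y)\<close> to it are at most those that lead from \<open>(x', y')\<close> to \<open>(a', b')\<close>.
  After shrinking to the frontier, they are admissible and score at least as high (\<open>transfer_rates\<close>).  The
  rates can coincide for different activities only if some input is reduced to zero.  If \<open>m \<le> s\<close>, this
  never happens at an optimum of the second score: expanding a single output, by whatever factor, keeps this score above
  \<open>1 - 1/s\<close>, whereas reducing one input to zero or below pushes it down to at most \<open>1 - 1/m \<le> 1 -
  1/s\<close>.  For the same reason negative target inputs do not occur at an optimum, so that both families of rates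
  give the same measure.
\<close>

section \<open>Trading between components and closedness of the cone\<close>

text \<open>
  Gordan's alternative: otherwise a hyperplane separates the vectors that are positive off \<open>i\<close> from those that
  lie, off \<open>i\<close>, below a nonnegative combination of the columns of \<open>A\<close>.  Neither set restricts the \<open>i\<close>-th
  coordinate, so its normal is a nonzero nonnegative weight vector with \<open>i\<close>-th entry \<open>0\<close>.
\<close>

lemma trade_direction:
  fixes A :: "real ^ 'k ^ 'd::finite"
  assumes weights: "\<And>v. 0 \<le> v \<Longrightarrow> v v* A \<le> 0 \<Longrightarrow> v \<noteq> 0 \<Longrightarrow> strictly_positive v"
  shows "\<exists>a\<ge>0. \<forall>l. l \<noteq> i \<longrightarrow> 0 < (A *v a) $ l"
proof (rule ccontr)
  assume none: "\<not> ?thesis"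
  define C where "C = {c. \<exists>a\<ge>0. \<forall>l. l \<noteq> i \<longrightarrow> c $ l \<le> (A *v a) $ l}"
  define U :: "(real ^ 'd) set" where "U = {c. \<forall>l. l \<noteq> i \<longrightarrow> 0 < c $ l}"
  have C_zero: "c \<in> C" if "\<And>l. l \<noteq> i \<Longrightarrow> c $ l \<le> 0" for c
    unfolding C_def using that by (auto intro!: exI[of _ 0])
  have "convex C"
  proof (rule convexI)
    fix c d :: "real ^ 'd" and p q :: real
    assume "c \<in> C" "d \<in> C" and pq: "0 \<le> p" "0 \<le> q"
    then obtain a b where ab: "0 \<le> a" "0 \<le> b"
        "\<And>l. l \<noteq> i \<Longrightarrow> c $ l \<le> (A *v a) $ l" "\<And>l. l \<noteq> i \<Longrightarrow> d $ l \<le> (A *v b) $ l"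
      unfolding C_def by blast
    have "A *v (p *\<^sub>R a + q *\<^sub>R b) = p *\<^sub>R (A *v a) + q *\<^sub>R (A *v b)"
      by (simp add: linear_add linear_scale)
    then show "p *\<^sub>R c + q *\<^sub>R d \<in> C"
      unfolding C_def using ab pq
      by (auto intro!: exI[of _ "p *\<^sub>R a + q *\<^sub>R b"] add_mono mult_left_mono
          simp: less_eq_vec_def)
  qed
  moreover have "convex U"
  proof -
    have "U = (\<Inter>l\<in>{l. l \<noteq> i}. {c. c \<bullet> axis l 1 > 0})"
      by (auto simp: U_def inner_axis)
    then show ?thesis
      by (auto intro!: convex_INT simp: inner_commute[of _ "axis _ _"] convex_halfspace_gt)
  qed
  moreover have "C \<noteq> {}"
    using C_zero[of 0] by auto
  moreover have "U \<noteq> {}"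
    unfolding U_def by (auto intro!: exI[of _ "\<chi> l. 1"])
  moreover have "C \<inter> U = {}"
    unfolding C_def U_def using none by (force intro: less_le_trans)
  ultimately obtain v b where v: "v \<noteq> 0" "\<And>c. c \<in> C \<Longrightarrow> v \<bullet> c \<le> b" "\<And>c. c \<in> U \<Longrightarrow> b \<le> v \<bullet> c"
    using separating_hyperplane_sets[of C U] by blast
  \<comment> \<open>\<open>U\<close> contains arbitrarily small multiples of \<open>(1, ..., 1)\<close>, so the two sets are separated at level \<open>0\<close>.\<close>
  have "b \<le> 0"
  proof (rule field_le_epsilon)
    fix e :: real assume "0 < e"
    define n where "n = \<bar>v \<bullet> (\<chi> l. 1)\<bar> + 1"
    have "n > 0" unfolding n_def by linarith
    have "b \<le> v \<bullet> ((e / n) *\<^sub>R (\<chi> l. 1))"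
      using \<open>n > 0\<close> \<open>0 < e\<close> by (intro v(3)) (auto simp: U_def)
    also have "\<dots> = (v \<bullet> (\<chi> l. 1)) * (e / n)"
      by simp
    also have "\<dots> \<le> n * (e / n)"
      using \<open>n > 0\<close> \<open>0 < e\<close> by (intro mult_right_mono) (auto simp: n_def)
    finally show "b \<le> 0 + e" using \<open>n > 0\<close> by simp
  qed
  then have C_le: "v \<bullet> c \<le> 0" if "c \<in> C" for c
    using v(2)[OF that] by simp
  have "v $ i = 0"
    using C_le[OF C_zero, of "axis i 1"] C_le[OF C_zero, of "axis i (- 1)"]
    by (simp add: inner_axis) (simp add: axis_def)
  moreover have "0 \<le> v"
    unfolding less_eq_vec_def
  proof
    fix l
    show "0 $ l \<le> v $ l"
      using C_le[OF C_zero, of "axis l (- 1)"] by (simp add: inner_axis) (simp add: axis_def)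
  qed
  moreover have "v v* A \<le> 0"
    unfolding less_eq_vec_def
  proof
    fix k
    have "(v v* A) $ k = v \<bullet> (A *v axis k 1)"
      by (simp add: dot_lmul_matrix[symmetric] inner_axis)
    also have "\<dots> \<le> 0"
      by (intro C_le) (auto simp: C_def less_eq_vec_def axis_def intro!: exI[of _ "axis k 1"])
    finally show "(v v* A) $ k \<le> 0 $ k" by simp
  qed
  ultimately show False
    using weights[of v] v(1) by (metis less_irrefl strictly_positive_def)
qed

lemma convex_cone_orthant: "convex_cone {x :: 'a::ordered_euclidean_space. 0 \<le> x}"
  by (auto simp: convex_cone_iff intro: scaleR_nonneg_nonneg)

text \<open>
  The image is the convex cone generated by the images of the basis vectors, and finitely generated cones are
  closed.
\<close>

lemma closed_linear_image_orthant:
  fixes f :: "'a::ordered_euclidean_space \<Rightarrow> 'b::euclidean_space"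
  assumes "linear f"
  shows "closed (f ` {x. 0 \<le> x})"
proof -
  let ?H = "convex_cone hull (f ` Basis)"
  have "f x \<in> ?H" if "0 \<le> x" for x
  proof -
    have coord: "0 \<le> x \<bullet> b" if "b \<in> Basis" for b
      using \<open>0 \<le> x\<close> that eucl_le[of 0 x] by simp
    have "(\<Sum>b\<in>F. (x \<bullet> b) *\<^sub>R f b) \<in> ?H" if "F \<subseteq> Basis" "finite F" for F
      using that(2,1)
      by induction (auto simp: convex_cone_hull_contains_0 hull_inc coord
          intro!: convex_cone_hull_add convex_cone_hull_mul)
    moreover have "f x = (\<Sum>b\<in>Basis. (x \<bullet> b) *\<^sub>R f b)"
      using linear_sum[OF assms, of "\<lambda>b. (x \<bullet> b) *\<^sub>R b" Basis]
      by (simp add: euclidean_representation linear_scale[OF assms])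
    ultimately show ?thesis by simp
  qed
  moreover have "?H \<subseteq> f ` {x. 0 \<le> x}"
  proof (rule hull_minimal)
    show "f ` Basis \<subseteq> f ` {x. 0 \<le> x}"
    proof (intro image_mono subsetI CollectI)
      fix b :: 'a assume "b \<in> Basis"
      then show "0 \<le> b" using eucl_le[of 0 b] by (simp add: inner_Basis)
    qed
    show "convex_cone (f ` {x. 0 \<le> x})"
      using assms by (simp add: convex_cone_linear_image convex_cone_orthant)
  qed
  ultimately have "f ` {x. 0 \<le> x} = ?H" by blast
  then show ?thesis by (simp add: closed_convex_cone_hull)
qed

text \<open>
  With slack variables \<open>p\<close> and \<open>q\<close> for the two inequalities, all defining data of a production set become one
  nonnegative vector.
\<close>

lemma production_set_eq_linear_image:
  fixes X :: "'n::finite \<Rightarrow> real ^ 'm::finite" and Y :: "'n \<Rightarrow> real ^ 's::finite"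
    and P :: "real ^ 'k ^ 'm" and Q :: "real ^ 'l ^ 's"
  defines "f \<equiv> \<lambda>(lam :: real ^ 'n, alpha, beta, p, q).
    ((\<Sum>j\<in>UNIV. lam $ j *\<^sub>R X j) - P *v alpha + p, (\<Sum>j\<in>UNIV. lam $ j *\<^sub>R Y j) + Q *v beta - q)"
  shows "linear f" and "production_set X Y P Q = f ` {w. 0 \<le> w}"
proof -
  show "linear f"
    by (rule linearI) (auto simp: f_def scaleR_add_left sum.distrib matrix_vector_right_distrib
        scaleR_sum_right scaleR_diff_right scaleR_add_right linear_scale)
  show "production_set X Y P Q = f ` {w. 0 \<le> w}" (is "?T = _")
  proof (rule set_eqI, rule iffI)
    fix z assume "z \<in> ?T"
    then obtain lam alpha beta where *: "\<forall>j. 0 \<le> lam j" "0 \<le> alpha" "0 \<le> beta"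
      "(\<Sum>j\<in>UNIV. lam j *\<^sub>R X j) - P *v alpha \<le> fst z" "snd z \<le> (\<Sum>j\<in>UNIV. lam j *\<^sub>R Y j) + Q *v beta"
      unfolding production_set_def by (auto simp: case_prod_beta)
    let ?w = "(\<chi> j. lam j, alpha, beta, fst z - ((\<Sum>j\<in>UNIV. lam j *\<^sub>R X j) - P *v alpha),
        (\<Sum>j\<in>UNIV. lam j *\<^sub>R Y j) + Q *v beta - snd z)"
    have "f ?w = z" by (simp add: f_def prod_eq_iff)
    moreover have "0 \<le> ?w" using * by (auto simp: less_eq_prod_def less_eq_vec_def)
    ultimately show "z \<in> f ` {w. 0 \<le> w}" by (metis (mono_tags, lifting) image_eqI mem_Collect_eq)
  next
    fix z assume "z \<in> f ` {w. 0 \<le> w}"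
    then obtain lam alpha beta p q where "z = f (lam, alpha, beta, p, q)" "0 \<le> lam" "0 \<le> alpha"
        "0 \<le> beta" "0 \<le> p" "0 \<le> q"
      by (auto simp: less_eq_prod_def)
    then show "z \<in> ?T"
      unfolding production_set_def f_def
      by (auto simp: less_eq_vec_def intro!: exI[of _ "\<lambda>j. lam $ j"] exI[of _ alpha] exI[of _ beta])
  qed
qed

lemma production_set_closed: "closed (production_set X Y P Q)"
  unfolding production_set_eq_linear_image(2)
  by (rule closed_linear_image_orthant[OF production_set_eq_linear_image(1)])

lemma production_set_convex_cone: "convex_cone (production_set X Y P Q)"
  unfolding production_set_eq_linear_image(2)
  by (rule convex_cone_linear_image[OF conjI[OF convex_cone_orthant production_set_eq_linear_image(1)]])

section \<open>Weak and strong efficiency\<close>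

definition strictly_dominates :: "('m::finite, 's::finite) activity \<Rightarrow> ('m, 's) activity \<Rightarrow> bool" where
  "strictly_dominates z z' \<longleftrightarrow> (\<forall>i. fst z $ i < fst z' $ i) \<and> (\<forall>r. snd z' $ r < snd z $ r)"

lemma strictly_dominates_imp_dominates: "strictly_dominates z z' \<Longrightarrow> dominates z z'"
  by (simp add: strictly_dominates_def dominates_def less_eq_vec_def less_imp_le)

lemma open_strictly_dominated: "open {w. strictly_dominates z w}"
proof -
  have "{w. strictly_dominates z w} =
      (\<Inter>i. {w. fst z $ i < fst w $ i}) \<inter> (\<Inter>r. {w. snd w $ r < snd z $ r})"
    by (auto simp: strictly_dominates_def)
  then show ?thesis
    by (auto intro!: open_INT open_Int open_Collect_less continuous_intros)
qed

text \<open>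
  Perturbations are scaled by such an \<open>e\<close> in order to keep finitely many strict inequalities.
\<close>

lemma small_multiple_below:
  fixes c d :: "'a::finite \<Rightarrow> real"
  assumes "\<And>i. 0 < d i"
  shows "\<exists>e>0. e \<le> 1 \<and> (\<forall>i. e * c i < d i)"
proof -
  have "eventually (\<lambda>e. e * c i < d i) (at_right 0)" for i
  proof -
    have "((\<lambda>e. e * c i) \<longlongrightarrow> 0 * c i) (at_right 0)" by (intro tendsto_intros)
    from order_tendstoD(2)[OF this, of "d i"] show ?thesis using assms[of i] by simp
  qed
  then have "eventually (\<lambda>e. \<forall>i. e * c i < d i) (at_right 0)"
    by (simp add: eventually_all_finite)
  moreover have "eventually (\<lambda>e. e \<in> {0<..<1}) (at_right (0::real))"
    by (rule eventually_at_right_real) simp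
  ultimately have "eventually (\<lambda>e. e \<in> {0<..<1} \<and> (\<forall>i. e * c i < d i)) (at_right (0::real))"
    by eventually_elim auto
  from eventually_happens'[OF _ this] show ?thesis
    by (auto intro: less_imp_le)
qed

lemma vec_less_witness: "(x :: real ^ 'd::finite) \<le> y \<Longrightarrow> x \<noteq> y \<Longrightarrow> \<exists>i. x $ i < y $ i"
  unfolding less_eq_vec_def vec_eq_iff by (metis less_le)

text \<open>
  The features of a production set on which the argument rests.  The two trades spread a slack of one
  component over all components of the same kind.  Between inputs and outputs, a slack is passed on by adding a
  productive activity (input slack to outputs) or by contracting (output slack to inputs).
\<close>

locale technology =
  fixes T :: "('m::finite, 's::finite) activity set"
  assumes closed: "closed T"
    and cone: "convex_cone T"
    and disposal: "z \<in> T \<Longrightarrow> dominates z z' \<Longrightarrow> z' \<in> T"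
    and input_trade: "\<exists>c. (c, 0) \<in> T \<and> (\<forall>l. l \<noteq> i \<longrightarrow> c $ l < 0)"
    and output_trade: "\<exists>c. (0, c) \<in> T \<and> (\<forall>l. l \<noteq> r \<longrightarrow> 0 < c $ l)"
    and productive: "\<exists>z\<in>T. 0 \<le> snd z \<and> snd z \<noteq> 0"
    and contractible: "z \<in> T \<Longrightarrow> 0 \<le> snd z \<Longrightarrow> snd z \<noteq> 0 \<Longrightarrow>
      \<exists>w. z - w \<in> T \<and> 0 \<le> fst w \<and> fst w \<noteq> 0"
    and efficient_exists: "strongly_efficient T \<noteq> {}"
begin

lemmas add = convex_cone_add[OF cone] and scale = convex_cone_scaleR[OF cone]

text \<open>
  Adding a free lunch to an efficient point would dominate that point.
\<close>

lemma no_free_lunch: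
  assumes "w \<in> T" "dominates w 0"
  shows "w = 0"
proof (rule ccontr)
  assume "w \<noteq> 0"
  obtain z where z: "z \<in> T" "\<And>z'. dominates z' z \<Longrightarrow> z' \<noteq> z \<Longrightarrow> z' \<notin> T"
    using efficient_exists by (auto simp: strongly_efficient_def)
  have "dominates (z + w) z"
    using assms(2) by (simp add: dominates_def)
  then show False using z add[OF z(1) assms(1)] \<open>w \<noteq> 0\<close> by simp
qed

text \<open>
  Otherwise normalised dominating points of growing norm accumulate at a unit vector of the closed cone \<open>T\<close>,
  which dominates \<open>0\<close> because the bounds from \<open>z\<close> vanish in the limit.
\<close>

lemma bounded_dominating: "bounded {w \<in> T. dominates w z}"
proof (rule ccontr)
  assume "\<not> ?thesis"
  then have "\<forall>n::nat. \<exists>w. w \<in> T \<and> dominates w z \<and> real n < norm w"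
    unfolding bounded_iff by (metis (mono_tags, lifting) linorder_not_less mem_Collect_eq)
  then obtain w where w: "\<And>n. w n \<in> T" "\<And>n. dominates (w n) z" "\<And>n. real n < norm (w n)"
    by metis
  define u where "u n = (1 / norm (w n)) *\<^sub>R w n" for n
  have pos: "0 < norm (w n)" for n
    using w(3)[of n] by (meson le_less_trans of_nat_0_le_iff)
  have "\<forall>n. u n \<in> sphere 0 1"
    using pos by (simp add: u_def)
  then obtain l k where l: "l \<in> sphere 0 1" "strict_mono k" "(u \<circ> k) \<longlonglongrightarrow> l"
    using seq_compactE[OF compact_imp_seq_compact[OF compact_sphere]] by blast
  have "u n \<in> T" for n
    unfolding u_def by (rule scale) (simp_all add: w(1))
  then have "l \<in> T"
    using closed_sequentially[OF closed _ l(3)] by simp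
  have inv: "(\<lambda>n. 1 / norm (w (k n))) \<longlonglongrightarrow> 0"
  proof (rule tendsto_sandwich[OF _ _ tendsto_const])
    show "(\<lambda>n. 1 / real n) \<longlonglongrightarrow> 0" by (rule lim_1_over_n)
    show "eventually (\<lambda>n. 0 \<le> 1 / norm (w (k n))) sequentially" by simp
    show "eventually (\<lambda>n. 1 / norm (w (k n)) \<le> 1 / real n) sequentially"
      using eventually_gt_at_top[of 0]
    proof eventually_elim
      case (elim n)
      have "real n \<le> norm (w (k n))"
        using w(3)[of "k n"] seq_suble[OF l(2), of n] by linarith
      then show ?case using elim by (simp add: frac_le)
    qed
  qed
  have "fst l $ i \<le> 0" for i
  proof (rule LIMSEQ_le)
    show "(\<lambda>n. fst ((u \<circ> k) n) $ i) \<longlonglongrightarrow> fst l $ i"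
      by (intro tendsto_intros l)
    show "(\<lambda>n. (1 / norm (w (k n))) * fst z $ i) \<longlonglongrightarrow> 0"
      using tendsto_mult_right[OF inv, of "fst z $ i"] by simp
    show "\<exists>N. \<forall>n\<ge>N. fst ((u \<circ> k) n) $ i \<le> (1 / norm (w (k n))) * fst z $ i"
      using w(2) pos by (auto simp: u_def dominates_def less_eq_vec_def divide_right_mono)
  qed
  moreover have "0 \<le> snd l $ r" for r
  proof (rule LIMSEQ_le)
    show "(\<lambda>n. snd ((u \<circ> k) n) $ r) \<longlonglongrightarrow> snd l $ r"
      by (intro tendsto_intros l)
    show "(\<lambda>n. (1 / norm (w (k n))) * snd z $ r) \<longlonglongrightarrow> 0"
      using tendsto_mult_right[OF inv, of "snd z $ r"] by simp
    show "\<exists>N. \<forall>n\<ge>N. (1 / norm (w (k n))) * snd z $ r \<le> snd ((u \<circ> k) n) $ r"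
      using w(2) pos by (auto simp: u_def dominates_def less_eq_vec_def divide_right_mono)
  qed
  ultimately have "dominates l 0" by (simp add: dominates_def less_eq_vec_def)
  then have "l = 0" using no_free_lunch \<open>l \<in> T\<close> by blast
  then show False using l(1) by simp
qed

lemma spread_input_slack:
  assumes "w \<in> T" "fst w \<le> x" "fst w $ i < x $ i"
  shows "\<exists>w'\<in>T. (\<forall>l. fst w' $ l < x $ l) \<and> snd w' = snd w"
proof -
  obtain c where c: "(c, 0) \<in> T" "\<And>l. l \<noteq> i \<Longrightarrow> c $ l < 0"
    using input_trade[of i] by blast
  obtain e where e: "0 < e" "e * c $ i < x $ i - fst w $ i"
    using small_multiple_below[of "\<lambda>_. x $ i - fst w $ i" "\<lambda>_. c $ i"] assms(3) by auto
  let ?w = "w + e *\<^sub>R (c, 0)"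
  have "fst ?w $ l < x $ l" for l
  proof (cases "l = i")
    case True
    then show ?thesis using e by simp
  next
    case False
    then have "e * c $ l < 0" using c e by (simp add: mult_pos_neg)
    moreover have "fst w $ l \<le> x $ l" using assms(2) by (simp add: less_eq_vec_def)
    ultimately show ?thesis by simp
  qed
  moreover have "?w \<in> T"
    using assms c e by (intro add scale) auto
  ultimately show ?thesis by (intro bexI[of _ ?w]) simp_all
qed

lemma spread_output_slack:
  assumes "w \<in> T" "y \<le> snd w" "y $ r < snd w $ r"
  shows "\<exists>w'\<in>T. (\<forall>l. y $ l < snd w' $ l) \<and> fst w' = fst w"
proof -
  obtain c where c: "(0, c) \<in> T" "\<And>l. l \<noteq> r \<Longrightarrow> 0 < c $ l"
    using output_trade[of r] by blast
  obtain e where e: "0 < e" "e * (- c $ r) < snd w $ r - y $ r"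
    using small_multiple_below[of "\<lambda>_. snd w $ r - y $ r" "\<lambda>_. - c $ r"] assms(3) by auto
  let ?w = "w + e *\<^sub>R (0, c)"
  have "y $ l < snd ?w $ l" for l
  proof (cases "l = r")
    case True
    then show ?thesis using e by simp
  next
    case False
    then have "0 < e * c $ l" using c e by simp
    moreover have "y $ l \<le> snd w $ l" using assms(2) by (simp add: less_eq_vec_def)
    ultimately show ?thesis by simp
  qed
  moreover have "?w \<in> T"
    using assms c e by (intro add scale) auto
  ultimately show ?thesis by (intro bexI[of _ ?w]) simp_all
qed

text \<open>
  Input slack is spread over all inputs; part of it pays for a small amount of a productive activity, and the
  resulting slack of one output is spread over all outputs.
\<close>

lemma input_slack_imp_strictly_dominated:
  assumes "w \<in> T" "fst w \<le> fst z" "fst w \<noteq> fst z" "snd z \<le> snd w"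
  shows "\<exists>w'\<in>T. strictly_dominates w' z"
proof -
  obtain i where "fst w $ i < fst z $ i"
    using vec_less_witness assms by blast
  then obtain w1 where w1: "w1 \<in> T" "\<And>l. fst w1 $ l < fst z $ l" "snd w1 = snd w"
    using spread_input_slack assms by blast
  obtain a where a: "a \<in> T" "0 \<le> snd a" "snd a \<noteq> 0"
    using productive by blast
  obtain r where r: "0 < snd a $ r"
    using vec_less_witness[of 0 "snd a"] a by auto
  obtain e where e: "0 < e" "\<And>l. e * fst a $ l < fst z $ l - fst w1 $ l"
    using small_multiple_below[of "\<lambda>l. fst z $ l - fst w1 $ l" "\<lambda>l. fst a $ l"] w1(2) by auto
  let ?w2 = "w1 + e *\<^sub>R a"
  have "?w2 \<in> T" using w1 a e by (intro add scale) auto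
  moreover have "snd z \<le> snd ?w2"
    using assms(4) a(2) e w1(3) by (auto simp: less_eq_vec_def intro: add_increasing2)
  moreover have "snd z $ r < snd ?w2 $ r"
  proof -
    have "snd z $ r \<le> snd w1 $ r" using assms(4) w1(3) by (simp add: less_eq_vec_def)
    then show ?thesis using mult_pos_pos[OF e(1) r] by simp
  qed
  ultimately obtain w3 where w3: "w3 \<in> T" "\<And>l. snd z $ l < snd w3 $ l" "fst w3 = fst ?w2"
    using spread_output_slack by blast
  have "fst w3 $ l < fst z $ l" for l
    using e(2)[of l] by (simp add: w3(3))
  then show ?thesis
    using w3 unfolding strictly_dominates_def by blast
qed

text \<open>
  Output slack is turned into input slack by a small contraction, which lowers some input while the outputs
  remain above those of \<open>z\<close>.  Nonnegative nonzero outputs make contraction possible.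
\<close>

lemma inefficient_imp_strictly_dominated:
  assumes "z \<in> T" "0 \<le> snd z" "snd z \<noteq> 0" "z \<notin> strongly_efficient T"
  shows "\<exists>w\<in>T. strictly_dominates w z"
proof -
  obtain w where w: "w \<in> T" "dominates w z" "w \<noteq> z"
    using assms by (auto simp: strongly_efficient_def)
  have le: "fst w \<le> fst z" "snd z \<le> snd w"
    using w(2) by (auto simp: dominates_def)
  show ?thesis
  proof (cases "fst w = fst z")
    case False
    then show ?thesis using input_slack_imp_strictly_dominated[OF w(1) le(1) _ le(2)] by blast
  next
    case True
    then have "snd z \<noteq> snd w" using w(3) by (auto simp: prod_eq_iff)
    then obtain r where "snd z $ r < snd w $ r"
      using vec_less_witness le by blast
    then obtain w1 where w1: "w1 \<in> T" "\<And>l. snd z $ l < snd w1 $ l" "fst w1 = fst w"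
      using spread_output_slack w(1) le by blast
    have nonneg: "0 \<le> snd z $ l" for l
      using assms(2) by (simp add: less_eq_vec_def)
    have "0 < snd w1 $ l" for l
      using nonneg[of l] w1(2)[of l] by linarith
    then have "0 \<le> snd w1" "snd w1 \<noteq> 0"
      by (auto simp: less_eq_vec_def less_imp_le vec_eq_iff dest: less_imp_neq[symmetric])
    then obtain d where d: "w1 - d \<in> T" "0 \<le> fst d" "fst d \<noteq> 0"
      using contractible w1(1) by blast
    obtain e where e: "0 < e" "e \<le> 1" "\<And>l. e * snd d $ l < snd w1 $ l - snd z $ l"
      using small_multiple_below[of "\<lambda>l. snd w1 $ l - snd z $ l" "\<lambda>l. snd d $ l"] w1(2) by auto
    \<comment> \<open>A step of length \<open>e\<close> stays in the convex set \<open>T\<close> and in the region where all outputs exceed those of \<open>z\<close>.\<close>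
    let ?w2 = "w1 - e *\<^sub>R d"
    have "?w2 = (1 - e) *\<^sub>R w1 + e *\<^sub>R (w1 - d)"
      by (simp add: algebra_simps)
    then have "?w2 \<in> T"
      using add[OF scale[OF _ w1(1), of "1 - e"] scale[OF _ d(1), of e]] e by simp
    moreover have "fst ?w2 \<le> fst z"
      using True w1(3) d(2) e by (auto simp: less_eq_vec_def)
    moreover have "fst ?w2 \<noteq> fst z"
      using True w1(3) d(3) e by simp
    moreover have "snd z $ l \<le> snd ?w2 $ l" for l
      using e(3)[of l] by simp
    then have "snd z \<le> snd ?w2"
      by (simp add: less_eq_vec_def)
    ultimately show ?thesis
      by (rule input_slack_imp_strictly_dominated)
  qed
qed

definition weakly_efficient :: "('m, 's) activity set" where
  "weakly_efficient = {z \<in> T. \<forall>w\<in>T. \<not> strictly_dominates w z}"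

lemma closed_weakly_efficient: "closed weakly_efficient"
proof -
  \<comment> \<open>Each constraint removes an open set.\<close>
  have "weakly_efficient = T \<inter> (\<Inter>w\<in>T. - {z. strictly_dominates w z})"
    by (auto simp: weakly_efficient_def)
  then show ?thesis
    using closed open_strictly_dominated by (metis closed_Compl closed_INT closed_Int)
qed

lemma weakly_efficient_iff:
  assumes "0 \<le> snd z" "snd z \<noteq> 0"
  shows "z \<in> weakly_efficient \<longleftrightarrow> z \<in> strongly_efficient T"
proof
  assume "z \<in> weakly_efficient"
  then show "z \<in> strongly_efficient T"
    using inefficient_imp_strictly_dominated[OF _ assms] unfolding weakly_efficient_def by blast
next
  assume z: "z \<in> strongly_efficient T"
  have "w \<noteq> z" if "strictly_dominates w z" for w
    using that by (auto simp: strictly_dominates_def)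
  then show "z \<in> weakly_efficient"
    using z strictly_dominates_imp_dominates unfolding strongly_efficient_def weakly_efficient_def by blast
qed

end

section \<open>Reduction and expansion rates\<close>

text \<open>
  The constraints on the rates in \<^const>\<open>Phi\<close> other than efficiency of the target.
\<close>

definition rates :: "('m::finite, 's::finite) activity \<Rightarrow> ('m, 's) activity set" where
  "rates z = {de. 0 \<le> fst de \<and> 0 \<le> snd de \<and>
      (\<forall>i. i \<notin> support (fst z) \<longrightarrow> fst de $ i = 0) \<and>
      (\<forall>r. r \<notin> support (snd z) \<longrightarrow> snd de $ r = 0)}"

lemma Phi_eq_rates: "Phi T z = {de \<in> rates z. target z de \<in> strongly_efficient T}"
  by (auto simp: Phi_def rates_def)

lemma semipositiveD:
  assumes "z \<in> semipositive_activities"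
  shows "0 \<le> fst z $ i" "0 \<le> snd z $ r" "0 \<le> fst z" "0 \<le> snd z" "snd z \<noteq> 0"
  using assms by (auto simp: semipositive_activities_def less_eq_vec_def)

lemma sum_axis_nth:
  "(\<Sum>i\<in>S. c i *\<^sub>R axis i (1::real)) $ j = (if j \<in> S then c j else 0)"
  for S :: "'d::finite set"
proof -
  have "(\<Sum>i\<in>S. c i *\<^sub>R axis i (1::real)) $ j = (\<Sum>i\<in>S. if i = j then c j else 0)"
    unfolding sum_component by (intro sum.cong) (auto simp: axis_def)
  then show ?thesis by simp
qed

lemma target_nth:
  assumes "z \<in> semipositive_activities"
  shows "fst (target z de) $ i = (1 - fst de $ i) * fst z $ i"
    and "snd (target z de) $ r = (1 + snd de $ r) * snd z $ r"
proof -
  have "fst z $ i = 0" if "i \<notin> support (fst z)"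
    using that semipositiveD(1)[OF assms, of i] by (simp add: support_def)
  moreover have "snd z $ r = 0" if "r \<notin> support (snd z)"
    using that semipositiveD(2)[OF assms, of r] by (simp add: support_def)
  ultimately show "fst (target z de) $ i = (1 - fst de $ i) * fst z $ i"
    and "snd (target z de) $ r = (1 + snd de $ r) * snd z $ r"
    by (auto simp: target_def sum_axis_nth algebra_simps simp del: sum_component)
qed

lemma target_zero: "target z 0 = z"
  by (simp add: target_def)

lemma continuous_on_target: "continuous_on S (target z)"
  unfolding target_def by (intro continuous_intros)

lemma rates_zero: "0 \<in> rates z"
  by (simp add: rates_def)

lemma rates_nonneg: "de \<in> rates z \<Longrightarrow> 0 \<le> fst de $ i" "de \<in> rates z \<Longrightarrow> 0 \<le> snd de $ r"
  by (auto simp: rates_def less_eq_vec_def)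

lemma rates_scale: "de \<in> rates z \<Longrightarrow> 0 \<le> t \<Longrightarrow> t *\<^sub>R de \<in> rates z"
  by (auto simp: rates_def less_eq_vec_def)

lemma closed_rates: "closed (rates z)"
proof -
  have "rates z = (\<Inter>i. {de. 0 \<le> fst de $ i}) \<inter> (\<Inter>r. {de. 0 \<le> snd de $ r}) \<inter>
     (\<Inter>i\<in>- support (fst z). {de. fst de $ i = 0}) \<inter> (\<Inter>r\<in>- support (snd z). {de. snd de $ r = 0})"
    by (auto simp: rates_def less_eq_vec_def)
  then show ?thesis
    by (simp only:) (intro closed_Int closed_INT ballI closed_Collect_le closed_Collect_eq continuous_intros)
qed

lemma target_dominates:
  assumes "z \<in> semipositive_activities" "de \<in> rates z"
  shows "dominates (target z de) z"
proof -
  have "(1 - fst de $ i) * fst z $ i \<le> fst z $ i" for i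
    using semipositiveD(1)[OF assms(1)] rates_nonneg(1)[OF assms(2)] by (simp add: algebra_simps)
  moreover have "snd z $ r \<le> (1 + snd de $ r) * snd z $ r" for r
    using semipositiveD(2)[OF assms(1)] rates_nonneg(2)[OF assms(2)] by (simp add: algebra_simps)
  ultimately show ?thesis
    by (simp add: dominates_def less_eq_vec_def target_nth[OF assms(1)])
qed

lemma target_output_semipositive:
  assumes "z \<in> semipositive_activities" "de \<in> rates z"
  shows "0 \<le> snd (target z de)" "snd (target z de) \<noteq> 0"
proof -
  have le: "snd z \<le> snd (target z de)"
    using target_dominates[OF assms] by (simp add: dominates_def)
  then show "0 \<le> snd (target z de)"
    using semipositiveD(4)[OF assms(1)] by (rule order_trans[rotated])
  show "snd (target z de) \<noteq> 0"
    using le semipositiveD(4,5)[OF assms(1)] by auto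
qed

section \<open>Scores as functions of the rates alone\<close>

text \<open>
  What the two output parts of the scores have in common and what the proofs use of them.
\<close>

definition output_factor :: "(real ^ 's::finite \<Rightarrow> real) \<Rightarrow> bool" where
  "output_factor f \<longleftrightarrow> continuous_on {e. 0 \<le> e} f \<and> f 0 = 1 \<and> (\<forall>e\<ge>0. 0 < f e) \<and>
     (\<forall>e e'. 0 \<le> e \<and> e \<le> e' \<and> e \<noteq> e' \<longrightarrow> f e' < f e)"

text \<open>
  The value of \<^const>\<open>g_in\<close> on rates that vanish off the support.
\<close>

definition input_factor :: "real ^ 'm::finite \<Rightarrow> real" where
  "input_factor d = 1 - (\<Sum>i\<in>UNIV. d $ i) / real CARD('m)"

definition score :: "(real ^ 's::finite \<Rightarrow> real) \<Rightarrow> ('m::finite, 's) activity \<Rightarrow> real" where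
  "score f de = input_factor (fst de) * f (snd de)"

text \<open>
  The value of \<^const>\<open>g_out\<close> on rates that vanish off the support: \<open>1 / (1 + mean of e)\<close>.
\<close>

definition inverse_mean_expansion :: "real ^ 's::finite \<Rightarrow> real" where
  "inverse_mean_expansion e = real CARD('s) / (real CARD('s) + (\<Sum>r\<in>UNIV. e $ r))"

text \<open>
  The value of \<^const>\<open>h_out\<close> on rates that vanish off the support, where each missing term of its sum is
  \<open>1 / (1 + 0)\<close>.
\<close>

definition mean_inverse_expansion :: "real ^ 's::finite \<Rightarrow> real" where
  "mean_inverse_expansion e = (\<Sum>r\<in>UNIV. 1 / (1 + e $ r)) / real CARD('s)"

lemma g_in_rates:
  assumes "de \<in> rates z"
  shows "g_in (fst z) (fst de) = input_factor (fst de)"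
proof -
  have "(\<Sum>i\<in>support (fst z). fst de $ i) = (\<Sum>i\<in>UNIV. fst de $ i)"
    using assms by (intro sum.mono_neutral_left) (auto simp: rates_def)
  then show ?thesis by (simp add: g_in_def input_factor_def)
qed

lemma score_S_rates:
  assumes "de \<in> rates z"
  shows "score_S z de = score inverse_mean_expansion de"
proof -
  have "(\<Sum>r\<in>support (snd z). snd de $ r) = (\<Sum>r\<in>UNIV. snd de $ r)"
    using assms by (intro sum.mono_neutral_left) (auto simp: rates_def)
  then show ?thesis
    by (simp add: score_S_def score_def g_in_rates[OF assms] g_out_def inverse_mean_expansion_def)
qed

lemma score_B_rates:
  fixes z :: "('m::finite, 's::finite) activity"
  assumes "de \<in> rates z"
  shows "score_B z de = score mean_inverse_expansion de"
proof -
  let ?S = "support (snd z)"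
  have "(\<Sum>r\<in>UNIV. 1 / (1 + snd de $ r)) = (\<Sum>r\<in>?S. 1 / (1 + snd de $ r)) + (\<Sum>r\<in>- ?S. 1 / (1 + snd de $ r))"
    by (metis Compl_partition disjoint_eq_subset_Compl finite order_refl sum.union_disjoint double_complement)
  also have "(\<Sum>r\<in>- ?S. 1 / (1 + snd de $ r)) = (\<Sum>r\<in>- ?S. 1)"
    using assms by (intro sum.cong) (auto simp: rates_def)
  also have "\<dots> = real CARD('s) - real (card ?S)"
    by (simp add: Compl_eq_Diff_UNIV card_Diff_subset of_nat_diff card_mono)
  finally have "h_out (snd z) (snd de) = mean_inverse_expansion (snd de)"
    by (simp add: h_out_def mean_inverse_expansion_def add_divide_distrib diff_divide_distrib)
  then show ?thesis
    by (simp add: score_B_def score_def g_in_rates[OF assms])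
qed

lemma output_factor_inverse_mean_expansion: "output_factor (inverse_mean_expansion :: real ^ 's::finite \<Rightarrow> real)"
proof -
  have nn: "0 \<le> (\<Sum>r\<in>UNIV. e $ r)" if "0 \<le> e" for e :: "real ^ 's"
    using that by (auto simp: less_eq_vec_def intro: sum_nonneg)
  have pos: "0 < real CARD('s) + (\<Sum>r\<in>UNIV. e $ r)" if "0 \<le> e" for e :: "real ^ 's"
    using nn[OF that] by (simp add: add_pos_nonneg)
  have "inverse_mean_expansion e' < inverse_mean_expansion e" if "0 \<le> e" "e \<le> e'" "e \<noteq> e'" for e e' :: "real ^ 's"
  proof -
    from vec_less_witness[OF that(2,3)] obtain r where "e $ r < e' $ r" ..
    then have "(\<Sum>r\<in>UNIV. e $ r) < (\<Sum>r\<in>UNIV. e' $ r)"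
      using that by (intro sum_strict_mono_ex1) (auto simp: less_eq_vec_def)
    then show ?thesis
      unfolding inverse_mean_expansion_def using pos[OF that(1)] by (intro divide_strict_left_mono) auto
  qed
  moreover have "continuous_on {e. 0 \<le> e} (inverse_mean_expansion :: real ^ 's \<Rightarrow> real)"
    unfolding inverse_mean_expansion_def using pos by (intro continuous_intros) (auto dest: less_imp_neq[OF pos])
  ultimately show ?thesis
    using pos by (auto simp: output_factor_def inverse_mean_expansion_def)
qed

lemma output_factor_mean_inverse_expansion: "output_factor (mean_inverse_expansion :: real ^ 's::finite \<Rightarrow> real)"
proof -
  have pos: "0 < 1 + e $ r" if "0 \<le> e" for e :: "real ^ 's" and r
    using that by (simp add: less_eq_vec_def add_pos_nonneg)
  have "mean_inverse_expansion e' < mean_inverse_expansion e" if "0 \<le> e" "e \<le> e'" "e \<noteq> e'" for e e' :: "real ^ 's"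
  proof -
    from vec_less_witness[OF that(2,3)] obtain r where r: "e $ r < e' $ r" ..
    have "(\<Sum>r\<in>UNIV. 1 / (1 + e' $ r)) < (\<Sum>r\<in>UNIV. 1 / (1 + e $ r))"
    proof (rule sum_strict_mono_ex1)
      show "\<forall>r\<in>UNIV. 1 / (1 + e' $ r) \<le> 1 / (1 + e $ r)"
        using that pos[OF that(1)] by (auto simp: less_eq_vec_def intro!: frac_le)
      show "\<exists>r\<in>UNIV. 1 / (1 + e' $ r) < 1 / (1 + e $ r)"
        using r pos[OF that(1), of r] by (auto intro!: bexI[of _ r] frac_less2)
    qed simp
    then show ?thesis unfolding mean_inverse_expansion_def by (simp add: divide_strict_right_mono)
  qed
  moreover have "continuous_on {e. 0 \<le> e} (mean_inverse_expansion :: real ^ 's \<Rightarrow> real)"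
    unfolding mean_inverse_expansion_def by (intro continuous_intros) (auto dest: less_imp_neq[OF pos])
  moreover have "0 < mean_inverse_expansion e" if "0 \<le> e" for e :: "real ^ 's"
    unfolding mean_inverse_expansion_def using pos[OF that] by (auto intro!: divide_pos_pos sum_pos)
  ultimately show ?thesis
    by (auto simp: output_factor_def mean_inverse_expansion_def)
qed

lemma output_factor_antimono:
  "output_factor f \<Longrightarrow> 0 \<le> e \<Longrightarrow> e \<le> e' \<Longrightarrow> f e' \<le> f e"
  unfolding output_factor_def by (cases "e = e'") (auto intro: less_imp_le)

lemma output_factor_pos: "output_factor f \<Longrightarrow> 0 \<le> e \<Longrightarrow> 0 < f e"
  by (simp add: output_factor_def)

lemma output_factor_le_1: "output_factor f \<Longrightarrow> 0 \<le> e \<Longrightarrow> f e \<le> 1"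
  using output_factor_antimono[of f 0 e] by (simp add: output_factor_def)

lemma input_factor_antimono: "d \<le> d' \<Longrightarrow> input_factor d' \<le> input_factor d"
  by (auto simp: input_factor_def less_eq_vec_def intro!: divide_right_mono sum_mono)

lemma input_factor_strict_antimono:
  assumes "d \<le> d'" "d \<noteq> d'"
  shows "input_factor d' < input_factor d"
proof -
  obtain i where "d $ i < d' $ i" using vec_less_witness assms by blast
  then have "(\<Sum>i\<in>UNIV. d $ i) < (\<Sum>i\<in>UNIV. d' $ i)"
    using assms by (intro sum_strict_mono_ex1) (auto simp: less_eq_vec_def)
  then show ?thesis by (simp add: input_factor_def divide_strict_right_mono)
qed

lemma score_antimono:
  assumes "output_factor f" "0 \<le> de" "de \<le> de'" "0 \<le> input_factor (fst de')"
  shows "score f de' \<le> score f de"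
proof -
  have le: "0 \<le> snd de" "fst de \<le> fst de'" "snd de \<le> snd de'"
    using assms by (auto simp: less_eq_prod_def)
  then have "0 \<le> snd de'" by (meson order_trans)
  then show ?thesis
    unfolding score_def using assms le
    by (intro mult_mono) (auto intro: input_factor_antimono output_factor_antimono less_imp_le
        output_factor_pos order_trans[OF _ input_factor_antimono])
qed

lemma score_strict_antimono:
  assumes "output_factor f" "0 \<le> de" "de \<le> de'" "de \<noteq> de'" "0 < input_factor (fst de')"
  shows "score f de' < score f de"
proof -
  have le: "0 \<le> snd de" "fst de \<le> fst de'" "snd de \<le> snd de'"
    using assms by (auto simp: less_eq_prod_def)
  then have nn: "0 \<le> snd de'" by (meson order_trans)
  have f: "0 < f (snd de')" "f (snd de') \<le> f (snd de)"
    using output_factor_pos output_factor_antimono assms(1) le nn by blast+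
  have g: "input_factor (fst de') \<le> input_factor (fst de)"
    using input_factor_antimono le by blast
  show ?thesis
  proof (cases "fst de = fst de'")
    case True
    then have "snd de \<noteq> snd de'" using assms(4) by (auto simp: prod_eq_iff)
    then have "f (snd de') < f (snd de)" using assms(1) le by (simp add: output_factor_def)
    then show ?thesis unfolding score_def using assms(5) True by simp
  next
    case False
    then have "input_factor (fst de') < input_factor (fst de)"
      using input_factor_strict_antimono le by blast
    then show ?thesis
      unfolding score_def using f assms(5) by (intro mult_less_le_imp_less) auto
  qed
qed

lemma score_le_input_factor:
  assumes "output_factor f" "0 \<le> snd de" "0 \<le> input_factor (fst de)"
  shows "score f de \<le> input_factor (fst de)"
  using assms output_factor_le_1[of f "snd de"] by (simp add: score_def mult_left_le)

lemma score_zero: "output_factor f \<Longrightarrow> score f 0 = 1"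
  by (simp add: score_def input_factor_def output_factor_def)

lemma score_le_1:
  assumes "output_factor f" "0 \<le> de"
  shows "score f de \<le> 1"
proof -
  have d: "0 \<le> fst de" "0 \<le> snd de"
    using assms(2) by (auto simp: less_eq_prod_def)
  have "input_factor (fst de) \<le> 1"
    using input_factor_antimono[OF d(1)] by (simp add: input_factor_def)
  moreover have "score f de \<le> 0" if "input_factor (fst de) < 0"
    using that output_factor_pos[OF assms(1) d(2)] by (simp add: score_def mult_neg_pos less_imp_le)
  ultimately show ?thesis
    using score_le_input_factor[OF assms(1) d(2)] by linarith
qed

lemma score_eq_1_imp_zero:
  fixes de :: "('m::finite, 's::finite) activity"
  assumes "output_factor f" "0 \<le> de" "score f de = 1"
  shows "de = 0"
proof (rule ccontr)
  assume "de \<noteq> 0"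
  have "0 < input_factor (fst de)"
    using assms output_factor_pos[OF assms(1), of "snd de"]
    by (metis less_eq_prod_def snd_zero score_def zero_less_mult_pos2 zero_less_one)
  then have "score f de < score f (0 :: ('m, 's) activity)"
    using score_strict_antimono[of f 0 de] assms \<open>de \<noteq> 0\<close> by auto
  then show False using assms by (simp add: score_zero)
qed

lemma max_over_eqI:
  assumes "a \<in> A" "\<And>b. b \<in> A \<Longrightarrow> f b \<le> f a"
  shows "max_over f A = f a"
  unfolding max_over_def using assms by (intro Greatest_equality) auto

lemma max_over_cong: "(\<And>a. a \<in> A \<Longrightarrow> f a = g a) \<Longrightarrow> max_over f A = max_over g A"
  by (simp add: max_over_def cong: image_cong)

lemma attains_max_cong: "(\<And>a. a \<in> A \<Longrightarrow> f a = g a) \<Longrightarrow> attains_max f A = attains_max g A"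
  by (simp add: attains_max_def)

lemma attains_maxE:
  assumes "attains_max f A"
  obtains a where "a \<in> A" "max_over f A = f a" "\<forall>b\<in>A. f b \<le> f a"
  using assms max_over_eqI[of _ A f] unfolding attains_max_def by metis

section \<open>Optimal rates and their monotonicity\<close>

context technology
begin

lemma Phi_weakly_efficient:
  assumes "z \<in> semipositive_activities"
  shows "Phi T z = rates z \<inter> target z -` weakly_efficient"
proof -
  have "target z de \<in> weakly_efficient \<longleftrightarrow> target z de \<in> strongly_efficient T" if "de \<in> rates z" for de
    using weakly_efficient_iff[OF target_output_semipositive[OF assms that]] .
  then show ?thesis unfolding Phi_eq_rates by blast
qed

lemma bounded_targets:
  assumes "z \<in> semipositive_activities"
  shows "\<exists>B\<ge>0. \<forall>de\<in>rates z. target z de \<in> T \<longrightarrow> norm (target z de) \<le> B"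
proof -
  obtain B where B: "\<And>w. w \<in> T \<Longrightarrow> dominates w z \<Longrightarrow> norm w \<le> B"
    using bounded_dominating[of z] unfolding bounded_iff by blast
  have "norm (target z de) \<le> \<bar>B\<bar>" if "de \<in> rates z" "target z de \<in> T" for de
    using B[OF that(2) target_dominates[OF assms that(1)]] by linarith
  then show ?thesis by (intro exI[of _ "\<bar>B\<bar>"]) simp
qed

lemma abs_fst_nth_le_norm: "\<bar>fst w $ i\<bar> \<le> norm w"
  and abs_snd_nth_le_norm: "\<bar>snd w $ r\<bar> \<le> norm w"
  for w :: "('m, 's) activity"
  using component_le_norm_cart[of "fst w" i] component_le_norm_cart[of "snd w" r]
    norm_fst_le[of "fst w" "snd w"] norm_snd_le[of "snd w" "fst w"] by auto

text \<open>
  Closed because strong efficiency of a target is the closed condition of weak efficiency; bounded because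
  targets are, and the rates on the support are affine functions of the target.
\<close>

lemma compact_Phi:
  assumes z: "z \<in> semipositive_activities"
  shows "compact (Phi T z)"
proof -
  have "closed (Phi T z)"
    unfolding Phi_weakly_efficient[OF z]
    by (intro closed_Int closed_rates closed_vimage closed_weakly_efficient continuous_on_target)
  moreover have "bounded (Phi T z)"
  proof -
    obtain B where B: "0 \<le> B" "\<And>de. de \<in> rates z \<Longrightarrow> target z de \<in> T \<Longrightarrow> norm (target z de) \<le> B"
      using bounded_targets[OF z] by blast
    let ?c = "(\<chi> i. 1 + B / fst z $ i, \<chi> r. B / snd z $ r) :: ('m, 's) activity"
    have "Phi T z \<subseteq> {0..?c}"
    proof
      fix de assume "de \<in> Phi T z"
      then have de: "de \<in> rates z" "target z de \<in> T"
        by (auto simp: Phi_eq_rates strongly_efficient_def)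
      \<comment> \<open>Off the support the quotient is \<open>B / 0 = 0\<close> and the bound is just 1.\<close>
      have "fst de $ i \<le> 1 + B / fst z $ i" for i
      proof (cases "i \<in> support (fst z)")
        case True
        then have x: "0 < fst z $ i" by (simp add: support_def)
        have "\<bar>(1 - fst de $ i) * fst z $ i\<bar> \<le> B"
          using abs_fst_nth_le_norm[of "target z de" i] B(2)[OF de] target_nth(1)[OF z, of de i] by simp
        then show ?thesis using x by (simp add: field_simps abs_le_iff)
      next
        case False
        then have "fst de $ i = 0" using de(1) by (simp add: rates_def)
        then show ?thesis using B(1) semipositiveD(1)[OF z] by (simp add: add_nonneg_nonneg)
      qed
      moreover have "snd de $ r \<le> B / snd z $ r" for r
      proof (cases "r \<in> support (snd z)")
        case True
        then have y: "0 < snd z $ r" by (simp add: support_def)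
        have "\<bar>(1 + snd de $ r) * snd z $ r\<bar> \<le> B"
          using abs_snd_nth_le_norm[of "target z de" r] B(2)[OF de] target_nth(2)[OF z, of de r] by simp
        then show ?thesis using y by (simp add: field_simps abs_le_iff)
      next
        case False
        then have "snd de $ r = 0" using de(1) by (simp add: rates_def)
        then show ?thesis using B(1) semipositiveD(2)[OF z] by simp
      qed
      ultimately have "de \<le> ?c"
        by (simp add: less_eq_prod_def less_eq_vec_def)
      moreover have "0 \<le> de" using de(1) by (simp add: rates_def less_eq_prod_def)
      ultimately show "de \<in> {0..?c}" by simp
    qed
    moreover have "bounded {0..?c}"
      using bounded_cbox[of 0 ?c] by (simp add: interval_cbox)
    ultimately show ?thesis using bounded_subset by blast
  qed
  ultimately show ?thesis by (simp add: compact_eq_bounded_closed)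
qed

lemma compact_Phi_nonneg:
  assumes z: "z \<in> semipositive_activities"
  shows "compact (Phi_nonneg T z)"
proof -
  have "Phi_nonneg T z = Phi T z \<inter> (\<Inter>i. {de. 0 \<le> fst (target z de) $ i})"
    by (auto simp: Phi_nonneg_def less_eq_vec_def)
  moreover have "closed {de. 0 \<le> fst (target z de) $ i}" for i
    by (intro closed_Collect_le continuous_intros continuous_on_target)
  ultimately show ?thesis
    using compact_Phi[OF z] by (auto intro!: compact_Int_closed closed_INT)
qed

text \<open>
  The target of \<open>t *\<^sub>R de\<close> moves along a segment from \<open>z\<close>.  At its last point in \<open>T\<close> nothing in \<open>T\<close> is strictly
  better, since otherwise free disposal would admit slightly larger \<open>t\<close>.
\<close>

lemma scale_to_frontier:
  assumes z: "z \<in> T" "z \<in> semipositive_activities" and de: "de \<in> rates z" "target z de \<notin> T"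
  obtains t where "0 \<le> t" "t < 1" "t *\<^sub>R de \<in> Phi T z"
proof -
  define S where "S = {0..1} \<inter> (\<lambda>t. target z (t *\<^sub>R de)) -` T"
  have cont: "continuous_on UNIV (\<lambda>t. target z (t *\<^sub>R de))"
    by (intro continuous_on_compose2[OF continuous_on_target[of UNIV]] continuous_intros subset_UNIV)
  have "compact S"
    unfolding S_def by (intro compact_Int_closed closed_vimage closed cont) simp
  moreover have "S \<noteq> {}"
  proof -
    have "0 \<in> S" using z(1) by (simp add: S_def target_zero)
    then show ?thesis by blast
  qed
  ultimately have "\<exists>t\<in>S. \<forall>t'\<in>S. t' \<le> t"
    by (rule compact_attains_sup)
  then obtain t where t: "t \<in> S" "\<And>t'. t' \<in> S \<Longrightarrow> t' \<le> t"
    by blast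
  then have "t \<noteq> 1" using de(2) by (auto simp: S_def)
  with t(1) have t01: "0 \<le> t" "t < 1" by (auto simp: S_def)
  have "target z (t *\<^sub>R de) \<in> weakly_efficient"
  proof (rule ccontr)
    assume "\<not> ?thesis"
    then obtain w where w: "w \<in> T" "strictly_dominates w (target z (t *\<^sub>R de))"
      using t(1) by (auto simp: weakly_efficient_def S_def)
    have "open ((\<lambda>t. target z (t *\<^sub>R de)) -` {v. strictly_dominates w v})"
      by (intro open_vimage open_strictly_dominated cont)
    then obtain e where e: "0 < e" "\<And>t'. dist t' t < e \<Longrightarrow> strictly_dominates w (target z (t' *\<^sub>R de))"
      using w(2) unfolding open_dist by (metis mem_Collect_eq vimage_eq)
    define t' where "t' = min 1 (t + e / 2)"
    have "t < t'" "t' \<le> 1" "dist t' t < e" using t01 e(1) by (auto simp: t'_def dist_real_def)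
    moreover from this have "target z (t' *\<^sub>R de) \<in> T"
      using disposal[OF w(1)] strictly_dominates_imp_dominates[OF e(2)] by blast
    ultimately have "t' \<in> S"
      using t01(1) by (simp add: S_def)
    then show False using t(2) \<open>t < t'\<close> by fastforce
  qed
  then have "t *\<^sub>R de \<in> Phi T z"
    using rates_scale[OF de(1) t01(1)] by (simp add: Phi_weakly_efficient[OF z(2)])
  then show ?thesis using that t01 by blast
qed

lemma scale_to_frontier_nonneg:
  assumes z: "z \<in> T" "z \<in> semipositive_activities"
    and de: "de \<in> rates z" "target z de \<notin> T" "0 \<le> fst (target z de)"
  obtains t where "0 \<le> t" "t < 1" "t *\<^sub>R de \<in> Phi_nonneg T z"
proof -
  obtain t where t: "0 \<le> t" "t < 1" "t *\<^sub>R de \<in> Phi T z"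
    using scale_to_frontier[OF z de(1,2)] .
  have "0 \<le> fst (target z (t *\<^sub>R de)) $ i" for i
  proof -
    have "fst (target z (t *\<^sub>R de)) $ i = (1 - t) * fst z $ i + t * fst (target z de) $ i"
      by (simp add: target_nth[OF z(2)] algebra_simps)
    then show ?thesis
      using t de(3) semipositiveD(1)[OF z(2)] by (simp add: less_eq_vec_def)
  qed
  then show ?thesis using that t by (simp add: Phi_nonneg_def less_eq_vec_def)
qed

text \<open>
  Zero input with semipositive output is infeasible, so the rates that remove all input can be shrunk to the
  frontier.
\<close>

lemma Phi_nonneg_nonempty:
  assumes z: "z \<in> T" "z \<in> semipositive_activities"
  shows "Phi_nonneg T z \<noteq> {}"
proof -
  define de :: "('m, 's) activity" where "de = (\<chi> i. if i \<in> support (fst z) then 1 else 0, 0)"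
  have de: "de \<in> rates z"
    by (auto simp: de_def rates_def less_eq_vec_def)
  have x: "fst (target z de) = 0"
    using semipositiveD(1)[OF z(2)] by (auto simp: vec_eq_iff target_nth[OF z(2)] de_def support_def less_le)
  have "target z de \<notin> T"
  proof
    assume "target z de \<in> T"
    moreover have "dominates (target z de) 0"
      using x target_output_semipositive(1)[OF z(2) de] by (simp add: dominates_def)
    ultimately have "target z de = 0" by (rule no_free_lunch)
    then show False using target_output_semipositive(2)[OF z(2) de] by simp
  qed
  then show ?thesis
    using scale_to_frontier_nonneg[OF z de] x by (metis empty_iff order_refl)
qed

lemma continuous_on_score:
  assumes "output_factor f"
  shows "continuous_on (rates z) (score f)"
proof -
  have "continuous_on (snd ` rates z) f"
    using assms by (auto simp: output_factor_def rates_def elim: continuous_on_subset)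
  then have "continuous_on (rates z) (\<lambda>de. f (snd de))"
    by (rule continuous_on_compose2) (auto intro: continuous_intros)
  then show ?thesis
    unfolding score_def input_factor_def by (intro continuous_on_mult continuous_intros) auto
qed

lemma score_attains_max:
  assumes z: "z \<in> T" "z \<in> semipositive_activities" and f: "output_factor f"
  shows "attains_max (score f) (Phi T z)" "attains_max (score f) (Phi_nonneg T z)"
proof -
  have attains: "attains_max (score f) K" if "compact K" "K \<noteq> {}" "K \<subseteq> rates z" for K
    unfolding attains_max_def
    using continuous_attains_sup[OF that(1,2) continuous_on_subset[OF continuous_on_score[OF f] that(3)]] .
  have sub: "Phi T z \<subseteq> rates z" "Phi_nonneg T z \<subseteq> Phi T z"
    by (auto simp: Phi_eq_rates Phi_nonneg_def)
  show "attains_max (score f) (Phi T z)"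
    using attains[OF compact_Phi[OF z(2)]] sub Phi_nonneg_nonempty[OF z] by blast
  show "attains_max (score f) (Phi_nonneg T z)"
    using attains[OF compact_Phi_nonneg[OF z(2)]] sub Phi_nonneg_nonempty[OF z] by blast
qed

lemma max_score_eq_1_iff:
  assumes z: "z \<in> semipositive_activities" and f: "output_factor f"
    and A: "A = Phi T z \<or> A = Phi_nonneg T z" "attains_max (score f) A"
  shows "max_over (score f) A = 1 \<longleftrightarrow> z \<in> strongly_efficient T"
proof
  have nonneg: "0 \<le> de" and target: "target z de \<in> strongly_efficient T" if "de \<in> A" for de
    using that A(1) by (auto simp: Phi_eq_rates Phi_nonneg_def rates_def less_eq_prod_def)
  {
    assume "max_over (score f) A = 1"
    then obtain de where "de \<in> A" "score f de = 1"
      using attains_maxE[OF A(2)] by metis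
    then have "de = 0"
      using score_eq_1_imp_zero[OF f nonneg] by blast
    then show "z \<in> strongly_efficient T"
      using target[OF \<open>de \<in> A\<close>] by (simp add: target_zero)
  next
    assume "z \<in> strongly_efficient T"
    then have "0 \<in> A"
      using A(1) rates_zero[of z] semipositiveD(3)[OF z] by (auto simp: Phi_eq_rates Phi_nonneg_def target_zero)
    then show "max_over (score f) A = 1"
      using max_over_eqI[of 0 A "score f"] score_le_1[OF f nonneg] by (simp add: score_zero[OF f])
  }
qed

lemma Phi_nonneg_rates_le_1:
  assumes "z \<in> semipositive_activities" "de \<in> Phi_nonneg T z"
  shows "fst de $ i \<le> 1"
proof (cases "i \<in> support (fst z)")
  case True
  then have "0 < fst z $ i" by (simp add: support_def)
  moreover have "0 \<le> (1 - fst de $ i) * fst z $ i"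
    using assms(2) unfolding target_nth(1)[OF assms(1), of de i, symmetric]
    by (simp add: Phi_nonneg_def less_eq_vec_def)
  ultimately show ?thesis by (simp add: zero_le_mult_iff)
next
  case False
  then show ?thesis using assms(2) by (simp add: Phi_nonneg_def Phi_eq_rates rates_def)
qed

text \<open>
  The rates \<open>de\<close> lead from \<open>z\<close> to the componentwise minimum of the inputs and maximum of the outputs of \<open>z\<close> and
  of the target of \<open>z'\<close>.  That point dominates an efficient one, so it is this one or infeasible.  In the
  infeasible case shrinking makes the rates differ from \<open>de'\<close>; in the other, equal rates and equal targets
  determine the activity, provided that no input is reduced to zero.
\<close>

lemma transfer_rates:
  assumes z: "z \<in> T" "z \<in> semipositive_activities" and z': "z' \<in> semipositive_activities"
    and dom: "dominates z z'" and de': "de' \<in> Phi_nonneg T z'"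
  obtains de where "de \<in> Phi_nonneg T z" "de \<le> de'"
    "z \<noteq> z' \<Longrightarrow> (\<And>i. fst de' $ i < 1) \<Longrightarrow> de \<noteq> de'"
proof -
  have le: "fst z $ i \<le> fst z' $ i" "snd z' $ r \<le> snd z $ r" for i r
    using dom by (auto simp: dominates_def less_eq_vec_def)
  have pos: "0 \<le> fst z $ i" "0 \<le> fst z' $ i" "0 \<le> snd z $ r" "0 \<le> snd z' $ r" for i r
    using semipositiveD z(2) z' by blast+
  have d1: "fst de' $ i \<le> 1" for i
    using Phi_nonneg_rates_le_1[OF z' de'] .
  have rates': "de' \<in> rates z'" and eff': "target z' de' \<in> strongly_efficient T"
    using de' by (auto simp: Phi_nonneg_def Phi_eq_rates)
  let ?a = "fst (target z' de')" and ?b = "snd (target z' de')"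
  note a = target_nth(1)[OF z', of de'] and b = target_nth(2)[OF z', of de']
  have b0: "0 \<le> ?b $ r" and a0: "0 \<le> ?a $ i" for r i
    using pos d1 rates_nonneg(2)[OF rates'] by (auto simp: a b)
  define de where "de = (\<chi> i. if fst z $ i = 0 then 0 else max 0 (1 - ?a $ i / fst z $ i),
      \<chi> r. if snd z $ r = 0 then 0 else max 0 (?b $ r / snd z $ r - 1))"
  have ta: "fst (target z de) $ i = min (?a $ i) (fst z $ i)" for i
    using pos(1)[of i] a0[of i]
    by (cases "fst z $ i = 0") (auto simp: target_nth[OF z(2)] de_def max_def min_def field_simps)
  have tb: "snd (target z de) $ r = max (?b $ r) (snd z $ r)" for r
  proof (cases "snd z $ r = 0")
    case True
    then have "?b $ r = 0" using pos(4)[of r] le(2)[of r] by (simp add: b)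
    then show ?thesis using True by (simp add: target_nth[OF z(2)])
  next
    case False
    then show ?thesis
      using pos(3)[of r] by (auto simp: target_nth[OF z(2)] de_def max_def field_simps)
  qed
  have rates: "de \<in> rates z"
    using pos by (auto simp: rates_def de_def less_eq_vec_def support_def less_le)
  have "fst de $ i \<le> fst de' $ i" for i
  proof (cases "fst z $ i = 0")
    case True
    then show ?thesis using rates_nonneg(1)[OF rates'] by (simp add: de_def)
  next
    case False
    then have x: "0 < fst z $ i" using pos(1)[of i] by simp
    have "(1 - fst de' $ i) * fst z $ i \<le> ?a $ i"
      unfolding a using le(1)[of i] d1[of i] by (intro mult_left_mono) auto
    then have "1 - fst de' $ i \<le> ?a $ i / fst z $ i"
      using x by (simp add: pos_le_divide_eq)
    then show ?thesis using False rates_nonneg(1)[OF rates', of i] by (simp add: de_def)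
  qed
  moreover have "snd de $ r \<le> snd de' $ r" for r
  proof (cases "snd z $ r = 0")
    case True
    then show ?thesis using rates_nonneg(2)[OF rates'] by (simp add: de_def)
  next
    case False
    then have y: "0 < snd z $ r" using pos(3)[of r] by simp
    have "?b $ r \<le> (1 + snd de' $ r) * snd z $ r"
      unfolding b using le(2)[of r] rates_nonneg(2)[OF rates', of r] by (intro mult_left_mono) auto
    then have "?b $ r / snd z $ r \<le> 1 + snd de' $ r"
      using y by (simp add: pos_divide_le_eq)
    then show ?thesis using False rates_nonneg(2)[OF rates', of r] by (simp add: de_def)
  qed
  ultimately have de_le: "de \<le> de'"
    by (simp add: less_eq_prod_def less_eq_vec_def)
  have nonneg: "0 \<le> fst (target z de)"
    using a0 pos by (simp add: less_eq_vec_def ta)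
  have dom': "dominates (target z de) (target z' de')"
    by (simp add: dominates_def less_eq_vec_def ta tb)
  show ?thesis
  proof (cases "target z de \<in> T")
    case True
    then have eq: "target z de = target z' de'"
      using eff' dom' unfolding strongly_efficient_def by blast
    have "z = z'" if lt1: "\<And>i. fst de' $ i < 1" and "de = de'"
    proof -
      have "fst z $ i = fst z' $ i" for i
        using arg_cong[OF eq, of "\<lambda>w. fst w $ i"] lt1[of i] \<open>de = de'\<close>
        by (simp add: target_nth z(2) z')
      moreover have "snd z $ r = snd z' $ r" for r
        using arg_cong[OF eq, of "\<lambda>w. snd w $ r"] rates_nonneg(2)[OF rates', of r] \<open>de = de'\<close>
        by (simp add: target_nth z(2) z' add_eq_0_iff)
      ultimately show ?thesis by (simp add: prod_eq_iff vec_eq_iff)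
    qed
    moreover have "de \<in> Phi_nonneg T z"
      using rates eff' eq nonneg by (simp add: Phi_nonneg_def Phi_eq_rates)
    ultimately show ?thesis using that de_le by blast
  next
    case False
    then obtain t where t: "0 \<le> t" "t < 1" "t *\<^sub>R de \<in> Phi_nonneg T z"
      using scale_to_frontier_nonneg[OF z rates _ nonneg] by blast
    have "0 \<le> de" using rates by (simp add: rates_def less_eq_prod_def)
    then have "t *\<^sub>R de \<le> de"
      using t scaleR_right_mono[of t 1 de] by simp
    moreover have "t *\<^sub>R de \<noteq> de'"
    proof
      assume "t *\<^sub>R de = de'"
      then have "t *\<^sub>R de = de" using calculation de_le by (simp add: order_antisym)
      then have "(1 - t) *\<^sub>R de = 0" by (simp add: scaleR_diff_left)
      then have "de = 0" using t(2) by simp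
      then show False using False z(1) by (simp add: target_zero)
    qed
    ultimately show ?thesis using that[OF t(3)] de_le by (meson order_trans)
  qed
qed

lemma max_score_mono:
  assumes z: "z \<in> T" "z \<in> semipositive_activities" and z': "z' \<in> T" "z' \<in> semipositive_activities"
    and dom: "dominates z z'" and f: "output_factor f"
  shows "max_over (score f) (Phi_nonneg T z') \<le> max_over (score f) (Phi_nonneg T z)"
proof -
  obtain de' where de': "de' \<in> Phi_nonneg T z'" "max_over (score f) (Phi_nonneg T z') = score f de'"
    using attains_maxE[OF score_attains_max(2)[OF z' f]] by metis
  obtain de where de: "de \<in> Phi_nonneg T z" "de \<le> de'"
    using transfer_rates[OF z z'(2) dom de'(1)] by metis
  have "0 \<le> de"
    using de(1) by (simp add: Phi_nonneg_def Phi_eq_rates rates_def less_eq_prod_def)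
  moreover have "(\<Sum>i\<in>UNIV. fst de' $ i) \<le> (\<Sum>i\<in>(UNIV :: 'm set). 1)"
    using Phi_nonneg_rates_le_1[OF z'(2) de'(1)] by (intro sum_mono) auto
  then have "0 \<le> input_factor (fst de')"
    by (simp add: input_factor_def divide_le_eq_1)
  ultimately have "score f de' \<le> score f de"
    using score_antimono[OF f] de(2) by blast
  also have "\<dots> \<le> max_over (score f) (Phi_nonneg T z)"
    using attains_maxE[OF score_attains_max(2)[OF z f]] de(1) by metis
  finally show ?thesis using de'(2) by simp
qed

lemma max_score_strict_mono:
  assumes z: "z \<in> T" "z \<in> semipositive_activities" and z': "z' \<in> T" "z' \<in> semipositive_activities"
    and dom: "dominates z z'" "z \<noteq> z'" and f: "output_factor f"
    and lt1: "\<And>de i. de \<in> Phi_nonneg T z' \<Longrightarrow>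
      score f de = max_over (score f) (Phi_nonneg T z') \<Longrightarrow> fst de $ i < 1"
  shows "max_over (score f) (Phi_nonneg T z') < max_over (score f) (Phi_nonneg T z)"
proof -
  obtain de' where de': "de' \<in> Phi_nonneg T z'" "max_over (score f) (Phi_nonneg T z') = score f de'"
    using attains_maxE[OF score_attains_max(2)[OF z' f]] by metis
  then have lt: "fst de' $ i < 1" for i
    using lt1 by simp
  obtain de where de: "de \<in> Phi_nonneg T z" "de \<le> de'" "de \<noteq> de'"
    using transfer_rates[OF z z'(2) dom(1) de'(1)] lt dom(2) by metis
  have "0 \<le> de"
    using de(1) by (simp add: Phi_nonneg_def Phi_eq_rates rates_def less_eq_prod_def)
  moreover have "(\<Sum>i\<in>UNIV. fst de' $ i) < (\<Sum>i\<in>(UNIV :: 'm set). 1)"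
    using lt by (intro sum_strict_mono) auto
  then have "0 < input_factor (fst de')"
    by (simp add: input_factor_def divide_less_eq_1)
  ultimately have "score f de' < score f de"
    using score_strict_antimono[OF f] de(2,3) by blast
  also have "\<dots> \<le> max_over (score f) (Phi_nonneg T z)"
    using attains_maxE[OF score_attains_max(2)[OF z f]] de(1) by metis
  finally show ?thesis using de'(2) by simp
qed

text \<open>
  Leaving the inputs alone and expanding one output so far that the target is infeasible costs less than one of
  the \<open>CARD('s)\<close> equally weighted terms of the output factor, and shrinking to the frontier costs nothing.
\<close>

lemma single_output_rates:
  assumes z: "z \<in> T" "z \<in> semipositive_activities"
  obtains de where "de \<in> Phi_nonneg T z" "1 - 1 / real CARD('s) < score mean_inverse_expansion de"
proof -
  obtain r where r: "0 < snd z $ r"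
    using vec_less_witness[of 0 "snd z"] semipositiveD(4,5)[OF z(2)] by auto
  obtain B where B: "0 \<le> B" "\<And>de. de \<in> rates z \<Longrightarrow> target z de \<in> T \<Longrightarrow> norm (target z de) \<le> B"
    using bounded_targets[OF z(2)] by blast
  \<comment> \<open>With this rate the \<open>r\<close>-th output exceeds the bound \<open>B\<close> for feasible targets.\<close>
  define c where "c = B / snd z $ r"
  have c: "0 \<le> c" using B(1) r by (simp add: c_def)
  define de :: "('m, 's) activity" where "de = (0, axis r c)"
  have de: "de \<in> rates z"
    using c r by (auto simp: de_def rates_def less_eq_vec_def axis_def support_def)
  have "snd (target z de) $ r = snd z $ r + B"
    using r by (simp add: target_nth[OF z(2)] de_def axis_def c_def field_simps)
  then have "B < norm (target z de)"
    using abs_snd_nth_le_norm[of "target z de" r] r B(1) by linarith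
  then have "target z de \<notin> T" using B(2)[OF de] by fastforce
  moreover have "0 \<le> fst (target z de)"
    using semipositiveD(1)[OF z(2)] by (simp add: less_eq_vec_def target_nth[OF z(2)] de_def)
  ultimately obtain t where t: "0 \<le> t" "t < 1" "t *\<^sub>R de \<in> Phi_nonneg T z"
    using scale_to_frontier_nonneg[OF z de] by blast
  have "(\<Sum>q\<in>UNIV. 1 / (1 + snd (t *\<^sub>R de) $ q)) = 1 / (1 + t * c) + (\<Sum>q\<in>UNIV - {r}. 1 / (1 + snd (t *\<^sub>R de) $ q))"
    by (subst sum.remove[of UNIV r]) (auto simp: de_def axis_def)
  also have "(\<Sum>q\<in>UNIV - {r}. 1 / (1 + snd (t *\<^sub>R de) $ q)) = (\<Sum>q\<in>UNIV - {r}. 1)"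
    by (intro sum.cong) (auto simp: de_def axis_def)
  also have "\<dots> = real CARD('s) - 1"
    by (simp add: card_Diff_singleton of_nat_diff)
  finally have "(\<Sum>q\<in>UNIV. 1 / (1 + snd (t *\<^sub>R de) $ q)) = 1 / (1 + t * c) + (real CARD('s) - 1)" .
  moreover have "0 < 1 / (1 + t * c)"
    using t(1) c by (simp add: add_pos_nonneg)
  ultimately have "real CARD('s) - 1 < (\<Sum>q\<in>UNIV. 1 / (1 + snd (t *\<^sub>R de) $ q))"
    by linarith
  then have "(real CARD('s) - 1) / real CARD('s) < score mean_inverse_expansion (t *\<^sub>R de)"
    by (simp add: score_def input_factor_def de_def mean_inverse_expansion_def divide_strict_right_mono)
  then show ?thesis using that t(3) by (simp add: diff_divide_distrib)
qed

text \<open>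
  A reduction rate of at least 1 alone brings the input factor down to at most \<open>1 - 1 / CARD('m)\<close>, which is no
  better than what the expansion of a single output beats.
\<close>

lemma optimal_input_rates_lt_1:
  assumes z: "z \<in> T" "z \<in> semipositive_activities" and card: "CARD('m) \<le> CARD('s)"
    and de: "de \<in> rates z" "\<And>de'. de' \<in> Phi_nonneg T z \<Longrightarrow> score mean_inverse_expansion de' \<le> score mean_inverse_expansion de"
  shows "fst de $ i < 1"
proof (rule ccontr)
  assume "\<not> ?thesis"
  then have "1 \<le> fst de $ i" by simp
  also have "\<dots> \<le> (\<Sum>k\<in>UNIV. fst de $ k)"
    using rates_nonneg(1)[OF de(1)] by (intro member_le_sum) auto
  finally have "1 / real CARD('m) \<le> (\<Sum>k\<in>UNIV. fst de $ k) / real CARD('m)"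
    by (intro divide_right_mono) auto
  moreover have "1 / real CARD('s) \<le> 1 / real CARD('m)"
    using card by (intro divide_left_mono) (auto simp: zero_less_card_finite)
  ultimately have g: "input_factor (fst de) \<le> 1 - 1 / real CARD('s)"
    by (simp add: input_factor_def)
  have d: "0 \<le> snd de" using de(1) by (simp add: rates_def)
  have "score mean_inverse_expansion de \<le> 1 - 1 / real CARD('s)"
  proof (cases "0 \<le> input_factor (fst de)")
    case True
    then show ?thesis using score_le_input_factor[OF output_factor_mean_inverse_expansion d] g by simp
  next
    case False
    then have "score mean_inverse_expansion de \<le> 0"
      using output_factor_pos[OF output_factor_mean_inverse_expansion d] by (simp add: score_def mult_nonpos_nonneg)
    also have "\<dots> \<le> 1 - 1 / real CARD('s)"
      by (simp add: divide_le_eq_1)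
    finally show ?thesis .
  qed
  moreover obtain de' where "de' \<in> Phi_nonneg T z" "1 - 1 / real CARD('s) < score mean_inverse_expansion de'"
    using single_output_rates[OF z] .
  ultimately show False
    using de(2)[of de'] by linarith
qed

text \<open>
  An optimum over the larger set reduces no input to zero, so its target has nonnegative inputs.
\<close>

lemma max_score_B_Phi_eq_Phi_nonneg:
  assumes z: "z \<in> T" "z \<in> semipositive_activities" and card: "CARD('m) \<le> CARD('s)"
  shows "max_over (score mean_inverse_expansion) (Phi T z) = max_over (score mean_inverse_expansion) (Phi_nonneg T z)"
proof -
  obtain de where de: "de \<in> Phi T z" "max_over (score mean_inverse_expansion) (Phi T z) = score mean_inverse_expansion de"
      "\<forall>de'\<in>Phi T z. score mean_inverse_expansion de' \<le> score mean_inverse_expansion de"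
    using attains_maxE[OF score_attains_max(1)[OF z output_factor_mean_inverse_expansion]] by blast
  have sub: "Phi_nonneg T z \<subseteq> Phi T z"
    by (auto simp: Phi_nonneg_def)
  have "fst de $ i < 1" for i
  proof (rule optimal_input_rates_lt_1[OF z card])
    show "de \<in> rates z" using de(1) by (simp add: Phi_eq_rates)
  qed (use de(3) sub in blast)
  then have "de \<in> Phi_nonneg T z"
    using de(1) semipositiveD(1)[OF z(2)]
    by (simp add: Phi_nonneg_def less_eq_vec_def target_nth[OF z(2)] less_imp_le)
  then have "max_over (score mean_inverse_expansion) (Phi_nonneg T z) = score mean_inverse_expansion de"
    using de(3) sub by (intro max_over_eqI) blast+
  then show ?thesis using de(2) by simp
qed

end

section \<open>Production sets under the weight conditions\<close>

lemma production_set_disposal: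
  assumes "z \<in> production_set X Y P Q" "dominates z z'"
  shows "z' \<in> production_set X Y P Q"
  using assms unfolding production_set_def dominates_def
  by (auto simp: case_prod_beta) (meson order_trans)

lemma sum_scaleR_drop_index:
  fixes f :: "'n::finite \<Rightarrow> 'v::real_vector"
  shows "(\<Sum>k\<in>UNIV. (if k = j then 0 else lam k) *\<^sub>R f k) = (\<Sum>k\<in>UNIV. lam k *\<^sub>R f k) - lam j *\<^sub>R f j"
proof -
  have "(\<Sum>k\<in>UNIV. (if k = j then 0 else lam k) *\<^sub>R f k) = (\<Sum>k\<in>UNIV - {j}. lam k *\<^sub>R f k)"
    by (intro sum.mono_neutral_cong_right) auto
  then show ?thesis by (simp add: sum_diff1)
qed

lemma unit_in_production_set: "(X j, Y j) \<in> production_set X Y P Q"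
  unfolding production_set_def case_prod_conv mem_Collect_eq
  by (intro exI[of _ "\<lambda>k. if k = j then 1 else 0"] exI[of _ 0])
    (simp add: if_distrib[of "\<lambda>c. c *\<^sub>R _"] cong: if_cong)

lemma input_ray_in_production_set: "0 \<le> a \<Longrightarrow> (- (P *v a), 0) \<in> production_set X Y P Q"
  unfolding production_set_def case_prod_conv mem_Collect_eq
  by (intro exI[of _ "\<lambda>_. 0"] exI[of _ a] exI[of _ 0]) simp

lemma output_ray_in_production_set: "0 \<le> b \<Longrightarrow> (0, Q *v b) \<in> production_set X Y P Q"
  unfolding production_set_def case_prod_conv mem_Collect_eq
  by (rule exI[of _ "\<lambda>_. 0"], rule exI[of _ 0], rule exI[of _ b]) simp

text \<open>
  Without active units the outputs would satisfy \<open>y \<le> Q *v beta\<close>, hence \<open>u \<bullet> y \<le> 0\<close>, although \<open>u\<close> is positive.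
\<close>

lemma positive_output_imp_active_unit:
  fixes Y :: "'n::finite \<Rightarrow> real ^ 's::finite" and Q :: "real ^ 'l ^ 's"
  assumes u: "strictly_positive u" "u v* Q \<le> 0"
    and y: "0 \<le> y" "y \<noteq> 0" "y \<le> (\<Sum>j\<in>UNIV. lam j *\<^sub>R Y j) + Q *v beta"
    and nonneg: "\<And>j. 0 \<le> lam j" "0 \<le> beta"
  shows "\<exists>j. 0 < lam j"
proof (rule ccontr)
  assume "\<not> ?thesis"
  then have "lam j = 0" for j using nonneg(1)[of j] by (auto simp: less_le)
  then have le: "y \<le> Q *v beta" using y(3) by simp
  obtain r where r: "0 < y $ r" using vec_less_witness[of 0 y] y by auto
  have "0 < u \<bullet> y"
    unfolding inner_vec_def using u(1) y(1) r
    by (intro sum_pos2[of _ r]) (auto simp: strictly_positive_def less_eq_vec_def less_imp_le)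
  also have "\<dots> \<le> u \<bullet> (Q *v beta)"
    unfolding inner_vec_def using u(1) le
    by (intro sum_mono) (auto simp: strictly_positive_def less_eq_vec_def less_imp_le)
  also have "\<dots> = (u v* Q) \<bullet> beta"
    by (simp add: dot_lmul_matrix)
  also have "\<dots> \<le> 0"
    unfolding inner_vec_def using u(2) nonneg(2)
    by (intro sum_nonpos) (auto simp: less_eq_vec_def mult_nonpos_nonneg)
  finally show False by simp
qed

text \<open>
  Positive output requires an active unit; switching it off saves its nonzero inputs.
\<close>

lemma production_set_contractible:
  fixes X :: "'n::finite \<Rightarrow> real ^ 'm::finite" and Y :: "'n \<Rightarrow> real ^ 's::finite"
    and P :: "real ^ 'k ^ 'm" and Q :: "real ^ 'l ^ 's"
  assumes units: "\<And>j. (X j, Y j) \<in> semipositive_activities"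
    and u: "strictly_positive u" "u v* Q \<le> 0"
    and z: "z \<in> production_set X Y P Q" "0 \<le> snd z" "snd z \<noteq> 0"
  shows "\<exists>w. z - w \<in> production_set X Y P Q \<and> 0 \<le> fst w \<and> fst w \<noteq> 0"
proof -
  obtain lam alpha beta where *: "\<And>j. 0 \<le> lam j" "0 \<le> alpha" "0 \<le> beta"
      "(\<Sum>j\<in>UNIV. lam j *\<^sub>R X j) - P *v alpha \<le> fst z" "snd z \<le> (\<Sum>j\<in>UNIV. lam j *\<^sub>R Y j) + Q *v beta"
    using z(1) unfolding production_set_def by (auto simp: case_prod_beta)
  obtain j where j: "0 < lam j"
    using positive_output_imp_active_unit[OF u z(2,3) *(5,1,3)] by blast
  let ?w = "lam j *\<^sub>R (X j, Y j)"
  have "z - ?w \<in> production_set X Y P Q"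
    unfolding production_set_def case_prod_beta
  proof (intro CollectI exI conjI allI)
    show "0 \<le> alpha" "0 \<le> beta" by fact+
    show "0 \<le> (if k = j then 0 else lam k)" for k using *(1) by simp
    show "(\<Sum>k\<in>UNIV. (if k = j then 0 else lam k) *\<^sub>R X k) - P *v alpha \<le> fst (z - ?w)"
      using *(4) unfolding sum_scaleR_drop_index by (simp add: less_eq_vec_def algebra_simps)
    show "snd (z - ?w) \<le> (\<Sum>k\<in>UNIV. (if k = j then 0 else lam k) *\<^sub>R Y k) + Q *v beta"
      using *(5) unfolding sum_scaleR_drop_index by (simp add: less_eq_vec_def algebra_simps)
  qed
  moreover have "0 \<le> fst ?w" "fst ?w \<noteq> 0"
    using units[of j] j by (auto simp: semipositive_activities_def less_eq_vec_def)
  ultimately show ?thesis by blast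
qed

lemma production_set_technology:
  fixes X :: "'n::finite \<Rightarrow> real ^ 'm::finite" and Y :: "'n \<Rightarrow> real ^ 's::finite"
    and P :: "real ^ 'k ^ 'm" and Q :: "real ^ 'l ^ 's"
  assumes units: "\<And>j. (X j, Y j) \<in> semipositive_activities"
    and input_weights: "{v. 0 \<le> v \<and> v v* P \<le> 0} \<subseteq> {v. strictly_positive v} \<union> {0}"
    and output_weights_nonempty: "{u. 0 \<le> u \<and> u v* Q \<le> 0 \<and> u \<noteq> 0} \<noteq> {}"
    and output_weights: "{u. 0 \<le> u \<and> u v* Q \<le> 0 \<and> u \<noteq> 0} \<subseteq> {u. strictly_positive u}"
    and frontier_nonempty: "strongly_efficient (production_set X Y P Q) \<noteq> {}"
  shows "technology (production_set X Y P Q)"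
proof
  let ?T = "production_set X Y P Q"
  show "closed ?T" "convex_cone ?T"
    by (rule production_set_closed production_set_convex_cone)+
  show "z' \<in> ?T" if "z \<in> ?T" "dominates z z'" for z z'
    using that by (rule production_set_disposal)
  show "\<exists>c. (c, 0) \<in> ?T \<and> (\<forall>l. l \<noteq> i \<longrightarrow> c $ l < 0)" for i
  proof -
    have "\<exists>a\<ge>0. \<forall>l. l \<noteq> i \<longrightarrow> 0 < (P *v a) $ l"
      using input_weights by (intro trade_direction) auto
    then obtain a where "0 \<le> a" "\<And>l. l \<noteq> i \<Longrightarrow> 0 < (P *v a) $ l" by blast
    then show ?thesis
      using input_ray_in_production_set[of a P] by (intro exI[of _ "- (P *v a)"]) auto
  qed
  show "\<exists>c. (0, c) \<in> ?T \<and> (\<forall>l. l \<noteq> r \<longrightarrow> 0 < c $ l)" for r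
  proof -
    have "\<exists>b\<ge>0. \<forall>l. l \<noteq> r \<longrightarrow> 0 < (Q *v b) $ l"
      using output_weights by (intro trade_direction) auto
    then obtain b where "0 \<le> b" "\<And>l. l \<noteq> r \<Longrightarrow> 0 < (Q *v b) $ l" by blast
    then show ?thesis
      using output_ray_in_production_set[of b Q] by (intro exI[of _ "Q *v b"]) auto
  qed
  show "\<exists>z\<in>?T. 0 \<le> snd z \<and> snd z \<noteq> 0"
    using unit_in_production_set[of X undefined Y P Q] semipositiveD(4,5)[OF units[of undefined]] by blast
  obtain u where "strictly_positive u" "u v* Q \<le> 0"
    using output_weights_nonempty output_weights by blast
  then show "\<exists>w. z - w \<in> ?T \<and> 0 \<le> fst w \<and> fst w \<noteq> 0"
    if "z \<in> ?T" "0 \<le> snd z" "snd z \<noteq> 0" for z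
    using production_set_contractible[OF units _ _ that] by blast
  show "strongly_efficient ?T \<noteq> {}" by fact
qed

theorem theorem10:
  fixes X :: "'n::finite \<Rightarrow> real ^ 'm::finite"
    and Y :: "'n \<Rightarrow> real ^ 's::finite"
    and P :: "real ^ 'k ^ 'm"
    and Q :: "real ^ 'l ^ 's"
    and T D :: "('m, 's) activity set"
  defines "T \<equiv> production_set X Y P Q"
    and "D \<equiv> T \<inter> semipositive_activities"
  assumes units: "\<And>j. (X j, Y j) \<in> semipositive_activities"
    and input_weights: "{v. 0 \<le> v \<and> v v* P \<le> 0} \<subseteq> {v. strictly_positive v} \<union> {0}"
    and output_weights_nonempty: "{u. 0 \<le> u \<and> u v* Q \<le> 0 \<and> u \<noteq> 0} \<noteq> {}"
    and output_weights: "{u. 0 \<le> u \<and> u v* Q \<le> 0 \<and> u \<noteq> 0} \<subseteq> {u. strictly_positive u}"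
    and frontier_nonempty: "strongly_efficient T \<noteq> {}"
  shows "(\<forall>z\<in>D. attains_max (score_S z) (Phi T z) \<and> attains_max (score_B z) (Phi T z) \<and>
             attains_max (score_S z) (Phi_nonneg T z) \<and> attains_max (score_B z) (Phi_nonneg T z)) \<and>
         axiom_I T (F_S (Phi T)) D \<and> axiom_I T (F_B (Phi T)) D \<and>
         axiom_I T (F_S (Phi_nonneg T)) D \<and> axiom_I T (F_B (Phi_nonneg T)) D \<and>
         axiom_WM (F_S (Phi_nonneg T)) D \<and> axiom_WM (F_B (Phi_nonneg T)) D \<and>
         (CARD('m) \<le> CARD('s) \<longrightarrow>
            axiom_WM (F_B (Phi T)) D \<and> axiom_SM (F_B (Phi T)) D \<and>
            axiom_SM (F_B (Phi_nonneg T)) D)"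
proof -
  interpret technology T
    using production_set_technology[OF units input_weights output_weights_nonempty output_weights]
      frontier_nonempty by (simp add: T_def)
  have D: "z \<in> T" "z \<in> semipositive_activities" if "z \<in> D" for z
    using that by (simp_all add: D_def)
  have rates: "de \<in> rates z" if "de \<in> Phi T z \<or> de \<in> Phi_nonneg T z" for de z
    using that by (auto simp: Phi_eq_rates Phi_nonneg_def)
  note SB = score_S_rates[OF rates] score_B_rates[OF rates]
  have F: "F_S (Phi T) z = max_over (score inverse_mean_expansion) (Phi T z)"
    "F_S (Phi_nonneg T) z = max_over (score inverse_mean_expansion) (Phi_nonneg T z)"
    "F_B (Phi T) z = max_over (score mean_inverse_expansion) (Phi T z)"
    "F_B (Phi_nonneg T) z = max_over (score mean_inverse_expansion) (Phi_nonneg T z)" for z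
    by (auto simp: F_S_def F_B_def SB intro!: max_over_cong)
  note factors = output_factor_inverse_mean_expansion output_factor_mean_inverse_expansion
  have attains: "attains_max (score_S z) (Phi T z)" "attains_max (score_S z) (Phi_nonneg T z)"
    "attains_max (score_B z) (Phi T z)" "attains_max (score_B z) (Phi_nonneg T z)" if "z \<in> D" for z
    using score_attains_max[OF D[OF that] factors(1)] score_attains_max[OF D[OF that] factors(2)]
    by (simp_all add: SB cong: attains_max_cong)
  have I: "axiom_I T (F_S (Phi T)) D" "axiom_I T (F_S (Phi_nonneg T)) D"
    "axiom_I T (F_B (Phi T)) D" "axiom_I T (F_B (Phi_nonneg T)) D"
    unfolding axiom_I_def F
    by (intro ballI max_score_eq_1_iff score_attains_max D factors disjI1[OF refl] disjI2[OF refl]; assumption)+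
  have WM: "axiom_WM (F_S (Phi_nonneg T)) D" "axiom_WM (F_B (Phi_nonneg T)) D"
    unfolding axiom_WM_def F using max_score_mono[OF D D] factors by blast+
  have card_le: "axiom_WM (F_B (Phi T)) D \<and> axiom_SM (F_B (Phi T)) D \<and> axiom_SM (F_B (Phi_nonneg T)) D"
    if card: "CARD('m) \<le> CARD('s)"
  proof -
    have SM: "axiom_SM (F_B (Phi_nonneg T)) D"
      unfolding axiom_SM_def F
    proof (intro ballI impI, elim conjE)
      fix z z' assume z: "z \<in> D" "z' \<in> D" "dominates z z'" "z \<noteq> z'"
      show "max_over (score mean_inverse_expansion) (Phi_nonneg T z') < max_over (score mean_inverse_expansion) (Phi_nonneg T z)"
      proof (rule max_score_strict_mono[OF D[OF z(1)] D[OF z(2)] z(3,4) factors(2)])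
        fix de i assume de: "de \<in> Phi_nonneg T z'" "score mean_inverse_expansion de = max_over (score mean_inverse_expansion) (Phi_nonneg T z')"
        show "fst de $ i < 1"
        proof (rule optimal_input_rates_lt_1[OF D[OF z(2)] card])
          show "de \<in> rates z'" using rates de(1) by blast
          show "score mean_inverse_expansion de' \<le> score mean_inverse_expansion de" if "de' \<in> Phi_nonneg T z'" for de'
            using attains_maxE[OF score_attains_max(2)[OF D[OF z(2)] factors(2)]] de(2) that by metis
        qed
      qed
    qed
    have "F_B (Phi T) z = F_B (Phi_nonneg T) z" if "z \<in> D" for z
      unfolding F using max_score_B_Phi_eq_Phi_nonneg[OF D[OF that] card] .
    then show ?thesis
      using SM WM(2) by (simp add: axiom_SM_def axiom_WM_def)
  qed
  show ?thesis
    using attains I WM card_le by blast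
qed

end
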